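(* Consider the networked feedback system described in the context and suppose it is mean-square input-output stable. Let the input $\{v(k)\}$ be an independent process, independent of $\{\tau_n\}$, with zero mean and bounded variances $\sigma_v^2(k)$. If $\sigma_v^2(k)\to\sigma_v^2$ as $k\to\infty$, then $\sigma_u^2(k)=\mathbb E\{u^2(k)\}$ converges and $$\lim_{k\to\infty}\sigma_u^2(k)=\frac{\|G(z)\|_2^2}{1-\|\Phi(z)G(z)\|_2^2}\,\sigma_v^2.$$
   Context: Setting: $P$ is a SISO discrete-time LTI plant, strictly proper (relative degree $\ge1$), $K$ a proper SISO LTI controller. Let $\tau\ge0$ be an integer, $\mathcal D=\{0,\dots,\tau\}$, $\{\tau_n\}$ i.i.d. with values in $\mathcal D$, $\Pr\{\tau_n=i\}=p_i$, $\sum_ip_i=1$. With real weights $\alpha_i$ and Kronecker delta $\delta$, the channel maps $u$ to $u_d(k)=\sum_{i=0}^{\tau}\alpha_i\delta(\tau_{k-i}-i)u(k-i)$. Closed loop: plant input $v-u_d$, plant output $y$, $u=Ky$; signals real, system at rest at $k=0$. Mean channel $H(z)=\sum_{i=0}^\tau\alpha_ip_iz^{-i}$. Let $\omega(k,n)=\alpha_{k-n}[\delta(\tau_n-(k-n))-p_{k-n}]$ for $n\le k\le n+\tau$, $0$ otherwise, and $d(k)=\sum_{i=0}^\tau\omega(k,k-i)u(k-i)$. Nominal system $G(z)=P(z)K(z)[1+P(z)K(z)H(z)]^{-1}$; the loop is $u=G(v-d)$. Mean-square input-output stable: $G$ stable (poles in open unit disc) and for every input $v$ that is zero-mean white noise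 with bounded variances and independent of $\{\tau_n\}$, $\mathbb E\{d^2(k)\}$ and $\mathbb E\{u^2(k)\}$ are bounded sequences. $\Phi(z)$ is a minimum-phase polynomial in $z^{-1}$ of degree $\tau$ with real coefficients such that $\Phi(z^{-1})\Phi(z)=\frac12\sum_{i_1,i_2=0}^{\tau}(\alpha_{i_1}z^{i_1}-\alpha_{i_2}z^{i_2})(\alpha_{i_1}z^{-i_1}-\alpha_{i_2}z^{-i_2})p_{i_1}p_{i_2}$. $\|F\|_2^2=\frac1{2\pi}\int_{-\pi}^{\pi}|F(e^{j\theta})|^2d\theta$. *)

theory Defs
  imports "HOL-Probability.Probability" "HOL-Computational_Algebra.Polynomial"
begin

text \<open>A real polynomial p represents the transfer function z \<mapsto> p(z^-1):
  coefficient i multiplies the delay z^-i.\<close>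

definition cpoly :: "real poly \<Rightarrow> complex poly" where
  "cpoly p = map_poly complex_of_real p"

definition evz :: "real poly \<Rightarrow> complex \<Rightarrow> complex" where
  "evz p z = poly (cpoly p) (inverse z)"

definition mean_chan :: "nat \<Rightarrow> (nat \<Rightarrow> real) \<Rightarrow> (nat \<Rightarrow> real) \<Rightarrow> real poly" where
  "mean_chan tmax \<alpha> p = (\<Sum>i\<le>tmax. monom (\<alpha> i * p i) i)"

text \<open>P = Pn/Pd, K = Kn/Kd; G = PK/(1+PKH) = (Pn Kn)/(Pd Kd + Pn Kn H).\<close>
definition G_num :: "real poly \<Rightarrow> real poly \<Rightarrow> real poly \<Rightarrow> real poly \<Rightarrow> real poly" where
  "G_num Pn Pd Kn Kd = Pn * Kn"

definition G_den :: "real poly \<Rightarrow> real poly \<Rightarrow> real poly \<Rightarrow> real poly \<Rightarrow> nat \<Rightarrow>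
    (nat \<Rightarrow> real) \<Rightarrow> (nat \<Rightarrow> real) \<Rightarrow> real poly" where
  "G_den Pn Pd Kn Kd tmax \<alpha> p = Pd * Kd + Pn * Kn * mean_chan tmax \<alpha> p"

definition G_tf :: "real poly \<Rightarrow> real poly \<Rightarrow> real poly \<Rightarrow> real poly \<Rightarrow> nat \<Rightarrow>
    (nat \<Rightarrow> real) \<Rightarrow> (nat \<Rightarrow> real) \<Rightarrow> complex \<Rightarrow> complex" where
  "G_tf Pn Pd Kn Kd tmax \<alpha> p z =
     evz (G_num Pn Pd Kn Kd) z / evz (G_den Pn Pd Kn Kd tmax \<alpha> p) z"

text \<open>The rational transfer function N(z^-1)/D(z^-1) is stable: all its poles lie in the
  open unit disc |z| < 1 (including no pole at z = infinity), i.e. in the variable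
  w = z^-1 it can be written with a denominator having no zeros in |w| <= 1.\<close>
definition stable_tf :: "real poly \<Rightarrow> real poly \<Rightarrow> bool" where
  "stable_tf N D \<longleftrightarrow> D \<noteq> 0 \<and>
     (\<exists>N' D'. cpoly N * D' = N' * cpoly D \<and> (\<forall>w. cmod w \<le> 1 \<longrightarrow> poly D' w \<noteq> 0))"

definition h2sq :: "(complex \<Rightarrow> complex) \<Rightarrow> real" where
  "h2sq F = integral {-pi..pi} (\<lambda>\<theta>. (cmod (F (cis \<theta>)))\<^sup>2) / (2 * pi)"

text \<open>Minimum phase polynomial in z^-1: all zeros of Phi(z) lie in the closed unit disc,
  i.e. Phi(w) (w = z^-1) has no zeros in |w| < 1.\<close>
definition min_phase :: "real poly \<Rightarrow> bool" where
  "min_phase \<Phi> \<longleftrightarrow> (\<forall>w. cmod w < 1 \<longrightarrow> poly (cpoly \<Phi>) w \<noteq> 0)"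

definition spectral_factor :: "nat \<Rightarrow> (nat \<Rightarrow> real) \<Rightarrow> (nat \<Rightarrow> real) \<Rightarrow> real poly \<Rightarrow> bool" where
  "spectral_factor tmax \<alpha> p \<Phi> \<longleftrightarrow> degree \<Phi> \<le> tmax \<and> min_phase \<Phi> \<and>
     (\<forall>z::complex. z \<noteq> 0 \<longrightarrow>
        poly (cpoly \<Phi>) z * poly (cpoly \<Phi>) (inverse z) =
        (1/2) * (\<Sum>i1\<le>tmax. \<Sum>i2\<le>tmax.
           (of_real (\<alpha> i1) * z ^ i1 - of_real (\<alpha> i2) * z ^ i2) *
           (of_real (\<alpha> i1) * inverse z ^ i1 - of_real (\<alpha> i2) * inverse z ^ i2) *
           of_real (p i1 * p i2)))"

text \<open>x(k - i), with the system at rest before time 0.\<close>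
definition sig :: "(nat \<Rightarrow> real) \<Rightarrow> nat \<Rightarrow> nat \<Rightarrow> real" where
  "sig x k i = (if i \<le> k then x (k - i) else 0)"

definition chan_out :: "nat \<Rightarrow> (nat \<Rightarrow> real) \<Rightarrow> (nat \<Rightarrow> nat) \<Rightarrow> (nat \<Rightarrow> real) \<Rightarrow> nat \<Rightarrow> real" where
  "chan_out tmax \<alpha> tau u k =
     (\<Sum>i\<le>tmax. if i \<le> k then \<alpha> i * (if tau (k - i) = i then 1 else 0) * u (k - i) else 0)"

definition dist_sig :: "nat \<Rightarrow> (nat \<Rightarrow> real) \<Rightarrow> (nat \<Rightarrow> real) \<Rightarrow> (nat \<Rightarrow> nat) \<Rightarrow> (nat \<Rightarrow> real) \<Rightarrow> nat \<Rightarrow> real" where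
  "dist_sig tmax \<alpha> p tau u k =
     (\<Sum>i\<le>tmax. if i \<le> k then \<alpha> i * ((if tau (k - i) = i then 1 else 0) - p i) * u (k - i) else 0)"

text \<open>Closed loop from rest at k = 0: plant Pd(q^-1) y = Pn(q^-1) (v - u_d),
  controller Kd(q^-1) u = Kn(q^-1) y, channel u -> u_d.\<close>
definition loop_eqs :: "real poly \<Rightarrow> real poly \<Rightarrow> real poly \<Rightarrow> real poly \<Rightarrow> nat \<Rightarrow> (nat \<Rightarrow> real) \<Rightarrow>
    (nat \<Rightarrow> real) \<Rightarrow> (nat \<Rightarrow> nat) \<Rightarrow> (nat \<Rightarrow> real) \<Rightarrow> (nat \<Rightarrow> real) \<Rightarrow> (nat \<Rightarrow> real) \<Rightarrow> bool" where
  "loop_eqs Pn Pd Kn Kd tmax \<alpha> v tau y u ud \<longleftrightarrow>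
     (\<forall>k. ud k = chan_out tmax \<alpha> tau u k) \<and>
     (\<forall>k. (\<Sum>i\<le>degree Pd. coeff Pd i * sig y k i) =
          (\<Sum>i\<le>degree Pn. coeff Pn i * sig (\<lambda>j. v j - ud j) k i)) \<and>
     (\<forall>k. (\<Sum>i\<le>degree Kd. coeff Kd i * sig u k i) =
          (\<Sum>i\<le>degree Kn. coeff Kn i * sig y k i))"

definition delay_iid :: "'a measure \<Rightarrow> nat \<Rightarrow> (nat \<Rightarrow> real) \<Rightarrow> (nat \<Rightarrow> 'a \<Rightarrow> nat) \<Rightarrow> bool" where
  "delay_iid M tmax p tau \<longleftrightarrow>
     prob_space.indep_vars M (\<lambda>_. count_space UNIV) tau UNIV \<and>
     (\<forall>n. \<forall>i\<le>tmax. measure M {\<omega> \<in> space M. tau n \<omega> = i} = p i) \<and>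
     (\<forall>n. AE \<omega> in M. tau n \<omega> \<le> tmax)"

definition indep_of_delays :: "'a measure \<Rightarrow> (nat \<Rightarrow> 'a \<Rightarrow> real) \<Rightarrow> (nat \<Rightarrow> 'a \<Rightarrow> nat) \<Rightarrow> bool" where
  "indep_of_delays M v tau \<longleftrightarrow>
     prob_space.indep_var M (PiM UNIV (\<lambda>_::nat. borel)) (\<lambda>\<omega> k. v k \<omega>)
                            (PiM UNIV (\<lambda>_::nat. count_space UNIV)) (\<lambda>\<omega> n. tau n \<omega>)"

definition white_noise :: "'a measure \<Rightarrow> (nat \<Rightarrow> 'a \<Rightarrow> real) \<Rightarrow> bool" where
  "white_noise M v \<longleftrightarrow>
     (\<forall>k. v k \<in> borel_measurable M \<and> integrable M (\<lambda>\<omega>. (v k \<omega>)\<^sup>2) \<and>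
          prob_space.expectation M (v k) = 0) \<and>
     (\<forall>k j. k \<noteq> j \<longrightarrow> prob_space.expectation M (\<lambda>\<omega>. v k \<omega> * v j \<omega>) = 0) \<and>
     (\<exists>B. \<forall>k. prob_space.expectation M (\<lambda>\<omega>. (v k \<omega>)\<^sup>2) \<le> B)"

text \<open>Canonical sample space carrying an input path and a delay path; any input/delay pair on
  any probability space induces a law on it, and the closed-loop signals are functions of
  these paths, so "for every admissible input" is quantified over laws on this space.\<close>
type_synonym canon = "(nat \<Rightarrow> real) \<times> (nat \<Rightarrow> nat)"

definition canon_space :: "canon measure" where
  "canon_space = PiM UNIV (\<lambda>_::nat. borel) \<Otimes>\<^sub>M PiM UNIV (\<lambda>_::nat. count_space UNIV)"

definition ms_stable :: "real poly \<Rightarrow> real poly \<Rightarrow> real poly \<Rightarrow> real poly \<Rightarrow> nat \<Rightarrow>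
    (nat \<Rightarrow> real) \<Rightarrow> (nat \<Rightarrow> real) \<Rightarrow> bool" where
  "ms_stable Pn Pd Kn Kd tmax \<alpha> p \<longleftrightarrow>
     stable_tf (G_num Pn Pd Kn Kd) (G_den Pn Pd Kn Kd tmax \<alpha> p) \<and>
     (\<forall>N :: canon measure. \<forall>y u ud :: canon \<Rightarrow> nat \<Rightarrow> real.
        prob_space N \<and> sets N = sets canon_space \<and>
        delay_iid N tmax p (\<lambda>n x. snd x n) \<and>
        white_noise N (\<lambda>k x. fst x k) \<and>
        indep_of_delays N (\<lambda>k x. fst x k) (\<lambda>n x. snd x n) \<and>
        (\<forall>x\<in>space N. loop_eqs Pn Pd Kn Kd tmax \<alpha> (fst x) (snd x) (y x) (u x) (ud x))
        \<longrightarrow>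
        (\<exists>B. \<forall>k. prob_space.expectation N (\<lambda>x. (dist_sig tmax \<alpha> p (snd x) (u x) k)\<^sup>2) \<le> B) \<and>
        (\<exists>B. \<forall>k. prob_space.expectation N (\<lambda>x. (u x k)\<^sup>2) \<le> B))"

end

theory Submission
  imports Defs "HOL-Complex_Analysis.Complex_Analysis"
begin

text \<open>
  Expanding \<open>u = G (v - d)\<close> and collecting the terms that contain \<open>u(n)\<close> gives
  \<open>u(k) = (g * v)(k) - (\<Sum>n<k. u(n) c\<^sub>n(k - n))\<close>, where \<open>g\<close> is the impulse response of \<open>G\<close> and
  \<open>c\<^sub>n\<close>, the response of \<open>G\<close> to the zero-mean channel deviation caused by \<open>\<tau>\<^sub>n\<close>, is independent
  of \<open>v\<close> and of \<open>u(0), \<dots>, u(n)\<close>. All terms are therefore orthogonal, and \<open>s(k) = E u(k)\<^sup>2\<close>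
  satisfies the renewal equation \<open>s = a + b * s\<close> with \<open>a(k) = (\<Sum>j\<le>k. g(j)\<^sup>2 \<sigma>\<^sup>2(k - j))\<close> and
  \<open>b(m) = E c\<^sub>n(m)\<^sup>2\<close>. By Parseval \<open>\<Sum>g\<^sup>2\<close> is the squared norm of \<open>G\<close> and \<open>\<Sum>b\<close> that of \<open>\<Phi> G\<close>, since
  \<open>\<bar>\<Phi>\<bar>\<^sup>2\<close> is the variance of the random channel on the unit circle.

  The renewal kernel \<open>r = 1/(1 - b)\<close> is nonnegative and \<open>s = r * a\<close>. Stability, tested with an
  independent sequence of random signs, makes \<open>s\<close> bounded while \<open>a\<close> stays away from zero (unless
  \<open>G = 0\<close>, and then \<open>b = 0\<close>); so \<open>r\<close> is
  summable, \<open>\<Sum>r = 1/(1 - \<Sum>b)\<close>, and \<open>s = r * a\<close> converges to \<open>\<Sum>r\<close> times the limit of \<open>a\<close>.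
\<close>

unbundle no vec_syntax

subsection \<open>Renewal equations\<close>

text \<open>The \<open>k\<close>-th sum becomes a series over all \<open>j\<close> by adding zero
  terms beyond \<open>k\<close>. Its \<open>j\<close>-th term tends to \<open>f j * L\<close> and is
  dominated by \<open>\<bar>f j\<bar> * B\<close>, where \<open>B\<close> bounds the convergent
  \<open>a\<close>, so Tannery's theorem exchanges limit and series.\<close>

lemma tendsto_convolution:
  fixes f a :: "nat \<Rightarrow> real"
  assumes f: "summable (\<lambda>j. \<bar>f j\<bar>)" and a: "a \<longlonglongrightarrow> L"
  shows "(\<lambda>k. \<Sum>j\<le>k. f j * a (k - j)) \<longlonglongrightarrow> suminf f * L"
proof -
  obtain B where B: "\<And>n. \<bar>a n\<bar> \<le> B"
    using convergent_imp_Bseq[of a] a by (auto simp: convergent_def Bseq_def)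
  have B0: "0 \<le> B"
    using B[of 0] by simp
  let ?t = "\<lambda>j k. if j \<le> k then f j * a (k - j) else 0"
  have lim: "?t j \<longlonglongrightarrow> f j * L" for j
  proof (rule Lim_transform_eventually)
    have "(\<lambda>k. a (k - j)) \<longlonglongrightarrow> L"
      using filterlim_compose[OF a filterlim_minus_const_nat_at_top] .
    then show "(\<lambda>k. f j * a (k - j)) \<longlonglongrightarrow> f j * L"
      by (intro tendsto_intros)
    show "\<forall>\<^sub>F k in sequentially. f j * a (k - j) = ?t j k"
      using eventually_ge_at_top[of j] by eventually_elim simp
  qed
  have "(\<lambda>k. \<Sum>j. ?t j k) \<longlonglongrightarrow> (\<Sum>j. f j * L)"
  proof (rule tannerys_theorem[THEN conjunct2, THEN conjunct2])
    show "\<forall>\<^sub>F (j, k) in sequentially \<times>\<^sub>F sequentially. norm (?t j k) \<le> \<bar>f j\<bar> * B"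
      using B B0 by (intro always_eventually) (auto simp: abs_mult intro!: mult_left_mono)
    show "summable (\<lambda>j. \<bar>f j\<bar> * B)"
      using f by (rule summable_mult2)
    show "(\<lambda>k. ?t j k) \<longlonglongrightarrow> f j * L" for j
      by (rule lim)
  qed simp
  moreover have "(\<Sum>j. ?t j k) = (\<Sum>j\<le>k. f j * a (k - j))" for k
  proof -
    have "(\<Sum>j. ?t j k) = (\<Sum>j\<le>k. ?t j k)"
      by (intro suminf_finite) auto
    then show ?thesis
      by simp
  qed
  moreover have "(\<Sum>j. f j * L) = suminf f * L"
    using suminf_mult2[OF summable_rabs_cancel[OF f], of L] by simp
  ultimately show ?thesis
    by simp
qed

text \<open>When \<open>b 0 = 0\<close> this is the sum of all convolution powers of
  \<open>b\<close>. Taking it as a formal power series postpones every question of convergence until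
  summability of the coefficients is known.\<close>

definition renewal_kernel :: "(nat \<Rightarrow> real) \<Rightarrow> real fps" where
  "renewal_kernel b = inverse (1 - Abs_fps b)"

lemma renewal_kernel_inverse:
  assumes "b 0 = 0"
  shows "renewal_kernel b * (1 - Abs_fps b) = 1"
  unfolding renewal_kernel_def using assms by (intro inverse_mult_eq_1) simp

lemma renewal_kernel_rec:
  assumes "b 0 = 0"
  shows "renewal_kernel b = 1 + renewal_kernel b * Abs_fps b"
  using renewal_kernel_inverse[of b, OF assms]
  unfolding right_diff_distrib mult_1_right by (simp only: diff_eq_eq)

text \<open>Strong induction along the coefficient recursion: the term \<open>i = k\<close>, which
  contains the coefficient itself, is killed by \<open>b 0 = 0\<close>, and only earlier
  coefficients with nonnegative weights remain.\<close>

lemma renewal_kernel_nonneg: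
  assumes b0: "b 0 = 0" and b: "\<And>m. 0 \<le> b m"
  shows "0 \<le> renewal_kernel b $ k"
proof (induction k rule: less_induct)
  case (less k)
  have "renewal_kernel b $ k = (1 + renewal_kernel b * Abs_fps b) $ k"
    by (rule arg_cong[OF renewal_kernel_rec[of b, OF b0]])
  also have "\<dots> = (if k = 0 then 1 else 0) + (\<Sum>i\<le>k. renewal_kernel b $ i * b (k - i))"
    by (simp add: fps_mult_nth atLeast0AtMost)
  also have "0 \<le> (\<Sum>i\<le>k. renewal_kernel b $ i * b (k - i))"
  proof (rule sum_nonneg)
    fix i assume "i \<in> {..k}"
    then show "0 \<le> renewal_kernel b $ i * b (k - i)"
      using less b b0 by (cases "i = k") auto
  qed
  then have "0 \<le> (if k = 0 then 1 else 0) + (\<Sum>i\<le>k. renewal_kernel b $ i * b (k - i))"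
    by simp
  finally show ?case .
qed

text \<open>As formal series the equation reads \<open>s = a + s * b\<close>, hence
  \<open>s * (1 - b) = a\<close>. The sum over \<open>n < k\<close> is a full Cauchy coefficient
  because the missing term carries the factor \<open>b 0\<close>.\<close>

lemma renewal_solution:
  assumes b0: "b 0 = 0"
    and s: "\<And>k. s k = a k + (\<Sum>n<k. s n * b (k - n))"
  shows "s k = (\<Sum>j\<le>k. renewal_kernel b $ j * a (k - j))"
proof -
  have "Abs_fps s $ k = (Abs_fps a + Abs_fps s * Abs_fps b) $ k" for k
    unfolding fps_mult_nth fps_add_nth fps_nth_Abs_fps atLeast0AtMost
    using s[of k] b0 by (simp flip: lessThan_Suc_atMost)
  then have "Abs_fps s = Abs_fps a + Abs_fps s * Abs_fps b"
    by (rule fps_ext)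
  then have "Abs_fps s * (1 - Abs_fps b) = Abs_fps a"
    unfolding right_diff_distrib mult_1_right by (simp only: diff_eq_eq)
  then have "Abs_fps s = renewal_kernel b * Abs_fps a"
    using renewal_kernel_inverse[of b, OF b0]
    by (metis mult.assoc mult.commute mult_1_right)
  from arg_cong[OF this, of "\<lambda>f. f $ k"] show ?thesis
    unfolding fps_mult_nth fps_nth_Abs_fps atLeast0AtMost .
qed

text \<open>Evaluate the solution formula at time \<open>n + m\<close>: for \<open>k \<le> n\<close>
  the kernel coefficient is paired with \<open>a\<close> at an index of at least \<open>m\<close>,
  where \<open>a\<close> is at least \<open>c\<close>. Thus \<open>c\<close> times the
  \<open>n\<close>-th partial sum is below \<open>s (n + m)\<close>, hence below
  \<open>B\<close>.\<close>

lemma renewal_kernel_summable: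
  assumes b0: "b 0 = 0" and b: "\<And>m. 0 \<le> b m"
    and s: "\<And>k. s k = a k + (\<Sum>n<k. s n * b (k - n))"
    and s_le: "\<And>k. s k \<le> B"
    and a: "\<And>k. 0 \<le> a k" and c: "0 < c" "\<And>k. m \<le> k \<Longrightarrow> c \<le> a k"
  shows "summable (\<lambda>k. renewal_kernel b $ k)"
proof (rule bounded_imp_summable)
  note r = renewal_kernel_nonneg[of b, OF b0 b]
  show "0 \<le> renewal_kernel b $ k" for k
    by (rule r)
  fix n
  have "(\<Sum>k\<le>n. renewal_kernel b $ k) * c = (\<Sum>k\<le>n. renewal_kernel b $ k * c)"
    by (rule sum_distrib_right)
  also have "\<dots> \<le> (\<Sum>k\<le>n. renewal_kernel b $ k * a (n + m - k))"
    using r c by (intro sum_mono mult_left_mono) auto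
  also have "\<dots> \<le> (\<Sum>k\<le>n + m. renewal_kernel b $ k * a (n + m - k))"
    using r a by (intro sum_mono2) auto
  also have "\<dots> = s (n + m)"
    by (rule renewal_solution[OF b0 s, symmetric])
  also have "\<dots> \<le> B"
    by (rule s_le)
  finally show "(\<Sum>k\<le>n. renewal_kernel b $ k) \<le> B / c"
    using c by (simp add: field_simps)
qed

lemma suminf_renewal_kernel:
  assumes b0: "b 0 = 0" and b: "\<And>m. 0 \<le> b m" and "summable b"
    and r: "summable (\<lambda>k. renewal_kernel b $ k)"
  shows "(\<Sum>k. renewal_kernel b $ k) = 1 / (1 - suminf b)"
proof -
  let ?r = "\<lambda>k. renewal_kernel b $ k"
  have "(\<lambda>k. \<Sum>i\<le>k. ?r i * b (k - i)) sums (suminf ?r * suminf b)"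
    using assms renewal_kernel_nonneg[of b, OF b0 b] by (intro Cauchy_product_sums) auto
  from sums_add[OF sums_single[of 0 "\<lambda>_. 1::real"] this]
  have sums: "(\<lambda>k. (if k = 0 then 1 else 0) + (\<Sum>i\<le>k. ?r i * b (k - i)))
      sums (1 + suminf ?r * suminf b)" .
  have "(if k = 0 then 1 else 0) + (\<Sum>i\<le>k. ?r i * b (k - i)) = ?r k" for k
    by (subst (2) renewal_kernel_rec[of b, OF b0]) (simp add: fps_mult_nth atLeast0AtMost)
  from sums[unfolded this] have "suminf ?r = 1 + suminf ?r * suminf b"
    by (rule sums_unique[symmetric])
  then have "suminf ?r * (1 - suminf b) = 1"
    unfolding right_diff_distrib by linarith
  \<comment> \<open>A product equal to 1 excludes \<open>suminf b = 1\<close>, so the division is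
    legitimate.\<close>
  then show ?thesis
    by (metis mult_zero_right nonzero_eq_divide_eq zero_neq_one)
qed

text \<open>This is the transient case of the renewal theorem: summability of the nonnegative kernel
  forces the total mass of \<open>b\<close> below 1, and \<open>s\<close> is the convolution of a
  summable kernel with a convergent sequence.\<close>

theorem renewal_limit:
  assumes b0: "b 0 = 0" and b: "\<And>m. 0 \<le> b m" and "summable b"
    and r: "summable (\<lambda>k. renewal_kernel b $ k)"
    and s: "\<And>k. s k = a k + (\<Sum>n<k. s n * b (k - n))"
    and a: "a \<longlonglongrightarrow> L"
  shows "s \<longlonglongrightarrow> L / (1 - suminf b)"
proof -
  have "(\<lambda>k. \<Sum>j\<le>k. renewal_kernel b $ j * a (k - j)) \<longlonglongrightarrow>
      (\<Sum>k. renewal_kernel b $ k) * L"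
    using r renewal_kernel_nonneg[of b, OF b0 b] a by (intro tendsto_convolution) auto
  moreover have "s = (\<lambda>k. \<Sum>j\<le>k. renewal_kernel b $ j * a (k - j))"
    by (intro ext renewal_solution[OF b0 s])
  ultimately show ?thesis
    by (simp add: suminf_renewal_kernel[OF b0 b assms(3) r])
qed

subsection \<open>Parseval's identity for stable transfer functions\<close>

text \<open>Orthogonality of the exponentials in real form; \<open>m\<close> is an integer because
  it will be a difference of two exponents.\<close>

lemma has_integral_cos_int:
  "((\<lambda>\<theta>. cos (of_int m * \<theta>)) has_integral (if m = 0 then 2 * pi else 0)) {-pi..pi}"
proof (cases "m = 0")
  case True
  then show ?thesis
    using has_integral_const_real[of "1::real" "-pi" pi] by simp
next
  case False
  have "((\<lambda>\<theta>. cos (of_int m * \<theta>)) has_integral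
      sin (of_int m * pi) / of_int m - sin (of_int m * - pi) / of_int m) {-pi..pi}"
    using False by (intro fundamental_theorem_of_calculus)
      (auto intro!: derivative_eq_intros simp flip: has_real_derivative_iff_has_vector_derivative)
  moreover have "sin (of_int m * pi) = 0"
    by (simp add: sin_zero_iff_int2)
  ultimately show ?thesis
    using False by simp
qed

lemma cmod_trig_sum_squared:
  fixes f :: "nat \<Rightarrow> real"
  shows "(cmod (\<Sum>k<N. of_real (f k) * inverse (cis \<theta>) ^ k))\<^sup>2 =
    (\<Sum>k<N. \<Sum>l<N. f k * f l * cos (of_int (int k - int l) * \<theta>))"
proof -
  have *: "of_real (f k) * inverse (cis \<theta>) ^ k = of_real (f k) * cis (- (real k * \<theta>))" for k
    by (simp add: cis_inverse Complex.DeMoivre)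
  have re: "Re (\<Sum>k<N. of_real (f k) * inverse (cis \<theta>) ^ k) = (\<Sum>k<N. f k * cos (real k * \<theta>))"
    unfolding * by simp
  have im: "Im (\<Sum>k<N. of_real (f k) * inverse (cis \<theta>) ^ k) = - (\<Sum>k<N. f k * sin (real k * \<theta>))"
    unfolding * by (simp add: sum_negf)
  have "(cmod (\<Sum>k<N. of_real (f k) * inverse (cis \<theta>) ^ k))\<^sup>2 =
      (\<Sum>k<N. f k * cos (real k * \<theta>))\<^sup>2 + (\<Sum>k<N. f k * sin (real k * \<theta>))\<^sup>2"
    unfolding cmod_power2 re im by simp
  also have "\<dots> = (\<Sum>k<N. \<Sum>l<N. f k * f l * cos (real k * \<theta> - real l * \<theta>))"
    unfolding power2_eq_square sum_product cos_diff sum.distrib[symmetric]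
    by (intro sum.cong refl) (simp add: algebra_simps)
  also have "\<dots> = (\<Sum>k<N. \<Sum>l<N. f k * f l * cos (of_int (int k - int l) * \<theta>))"
    by (simp add: algebra_simps)
  finally show ?thesis .
qed

text \<open>For a partial sum, orthogonality leaves only the diagonal of the double sum. All partial
  sums are bounded by the absolute sum \<open>B\<close>, so dominated convergence carries the
  identity to the limit. Squares are summable since the terms are eventually below 1 in
  modulus.\<close>

lemma parseval_power_series:
  fixes f :: "nat \<Rightarrow> real"
  assumes f: "summable (\<lambda>k. \<bar>f k\<bar>)"
  shows "summable (\<lambda>k. (f k)\<^sup>2)"
    and "((\<lambda>\<theta>. (cmod (\<Sum>k. of_real (f k) * inverse (cis \<theta>) ^ k))\<^sup>2)
      has_integral 2 * pi * (\<Sum>k. (f k)\<^sup>2)) {-pi..pi}"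
proof -
  let ?S = "\<lambda>N \<theta>. \<Sum>k<N. of_real (f k) * inverse (cis \<theta>) ^ k"
  let ?F = "\<lambda>\<theta>. \<Sum>k. of_real (f k) * inverse (cis \<theta>) ^ k"
  define B where "B = (\<Sum>k. \<bar>f k\<bar>)"
  have norm_term: "norm (of_real (f k) * inverse (cis \<theta>) ^ k) = \<bar>f k\<bar>" for k \<theta>
    by (simp add: norm_mult norm_power norm_inverse)
  have lim: "(\<lambda>N. ?S N \<theta>) \<longlonglongrightarrow> ?F \<theta>" for \<theta>
    by (intro summable_LIMSEQ summable_norm_cancel[of "\<lambda>k. of_real (f k) * inverse (cis \<theta>) ^ k"])
      (use f in \<open>simp only: norm_term\<close>)
  have bound: "cmod (?S N \<theta>) \<le> B" for N \<theta>
  proof -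
    have "cmod (?S N \<theta>) \<le> (\<Sum>k<N. \<bar>f k\<bar>)"
      using norm_sum[of "\<lambda>k. of_real (f k) * inverse (cis \<theta>) ^ k" "{..<N}"]
      by (simp only: norm_term)
    also have "\<dots> \<le> B"
      unfolding B_def using f by (intro sum_le_suminf) auto
    finally show ?thesis .
  qed
  have partial: "((\<lambda>\<theta>. (cmod (?S N \<theta>))\<^sup>2) has_integral 2 * pi * (\<Sum>k<N. (f k)\<^sup>2)) {-pi..pi}" for N
  proof -
    have "((\<lambda>\<theta>. \<Sum>k<N. \<Sum>l<N. f k * f l * cos (of_int (int k - int l) * \<theta>)) has_integral
        (\<Sum>k<N. \<Sum>l<N. f k * f l * (if int k - int l = 0 then 2 * pi else 0))) {-pi..pi}"
      by (intro has_integral_sum has_integral_mult_right has_integral_cos_int) auto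
    moreover have "(\<Sum>k<N. \<Sum>l<N. f k * f l * (if int k - int l = 0 then 2 * pi else 0)) =
        (\<Sum>k<N. \<Sum>l<N. if l = k then 2 * pi * (f k)\<^sup>2 else 0)"
      by (intro sum.cong) (auto simp: power2_eq_square)
    moreover have "\<dots> = 2 * pi * (\<Sum>k<N. (f k)\<^sup>2)"
      by (simp add: sum_distrib_left)
    ultimately show ?thesis
      unfolding cmod_trig_sum_squared by simp
  qed
  show sq: "summable (\<lambda>k. (f k)\<^sup>2)"
  proof (rule summable_comparison_test_ev)
    have "(\<lambda>k. \<bar>f k\<bar>) \<longlonglongrightarrow> 0"
      using f by (rule summable_LIMSEQ_zero)
    then have "\<forall>\<^sub>F k in sequentially. \<bar>f k\<bar> < 1"
      by (rule order_tendstoD) simp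
    then show "\<forall>\<^sub>F k in sequentially. norm ((f k)\<^sup>2) \<le> \<bar>f k\<bar>"
    proof eventually_elim
      case (elim k)
      then show ?case
        using mult_left_le[of "\<bar>f k\<bar>" "\<bar>f k\<bar>"] by (simp add: power2_eq_square abs_mult)
    qed
  qed (rule f)
  have int: "(\<lambda>\<theta>. (cmod (?S N \<theta>))\<^sup>2) integrable_on {-pi..pi}" for N
    using partial by blast
  have dom: "norm ((cmod (?S N \<theta>))\<^sup>2) \<le> B\<^sup>2" for N \<theta>
    using bound by (simp add: power_mono)
  note conv = dominated_convergence[OF int integrable_const_ivl[where c = "B\<^sup>2" and a = "-pi" and b = pi] dom
      tendsto_power[OF tendsto_norm[OF lim]]]
  have "(\<lambda>N. integral {-pi..pi} (\<lambda>\<theta>. (cmod (?S N \<theta>))\<^sup>2)) \<longlonglongrightarrow> 2 * pi * (\<Sum>k. (f k)\<^sup>2)"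
    unfolding integral_unique[OF partial] using sq by (intro tendsto_intros summable_LIMSEQ)
  with conv(2) have "integral {-pi..pi} (\<lambda>\<theta>. (cmod (?F \<theta>))\<^sup>2) = 2 * pi * (\<Sum>k. (f k)\<^sup>2)"
    by (rule LIMSEQ_unique)
  then show "((\<lambda>\<theta>. (cmod (?F \<theta>))\<^sup>2) has_integral 2 * pi * (\<Sum>k. (f k)\<^sup>2)) {-pi..pi}"
    using integrable_integral[OF conv(1)] by simp
qed

text \<open>On \<open>{-pi..pi}\<close> the angle of a point is its \<open>Arg\<close>, except that
  \<open>-pi\<close> gives the same point as \<open>pi\<close>.\<close>

lemma finite_cis_preimage:
  assumes "finite S"
  shows "finite {\<theta> \<in> {-pi..pi}. cis \<theta> \<in> S}"
proof (rule finite_subset)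
  show "{\<theta> \<in> {-pi..pi}. cis \<theta> \<in> S} \<subseteq> insert (-pi) (Arg ` S)"
  proof
    fix \<theta> assume \<theta>: "\<theta> \<in> {\<theta> \<in> {-pi..pi}. cis \<theta> \<in> S}"
    show "\<theta> \<in> insert (-pi) (Arg ` S)"
    proof (cases "\<theta> = -pi")
      case False
      then have "Arg (cis \<theta>) = \<theta>"
        using \<theta> by (intro cis_Arg_unique) (auto simp: sgn_cis)
      then show ?thesis
        using \<theta> by force
    qed simp
  qed
  show "finite (insert (-pi) (Arg ` S))"
    using assms by simp
qed

section \<open>Impulse responses of rational transfer functions\<close>

text \<open>The impulse response, that is, the expansion of the transfer function in
  \<open>w = z^-1\<close> around \<open>w = 0\<close>. The lemmas below assume
  \<open>coeff D 0 \<noteq> 0\<close>, which makes the denominator a unit among formal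
  series.\<close>

definition tf_fps :: "real poly \<Rightarrow> real poly \<Rightarrow> real fps" where
  "tf_fps N D = fps_of_poly N / fps_of_poly D"

lemma tf_fps_mult_den:
  assumes "coeff D 0 \<noteq> 0"
  shows "tf_fps N D * fps_of_poly D = fps_of_poly N"
  using assms unfolding tf_fps_def by (simp add: fps_divide_unit mult.assoc inverse_mult_eq_1)

lemma complex_tf_fps_mult_den:
  assumes "coeff D 0 \<noteq> 0"
  shows "Abs_fps (\<lambda>k. complex_of_real (tf_fps N D $ k)) * fps_of_poly (cpoly D) =
    fps_of_poly (cpoly N)"
proof (rule fps_ext)
  fix n
  have "(Abs_fps (\<lambda>k. complex_of_real (tf_fps N D $ k)) * fps_of_poly (cpoly D)) $ n =
      of_real ((tf_fps N D * fps_of_poly D) $ n)"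
    by (simp add: fps_mult_nth cpoly_def coeff_map_poly)
  also have "\<dots> = fps_of_poly (cpoly N) $ n"
    unfolding tf_fps_mult_den[OF assms] by (simp add: cpoly_def coeff_map_poly)
  finally show "(Abs_fps (\<lambda>k. complex_of_real (tf_fps N D $ k)) * fps_of_poly (cpoly D)) $ n =
      fps_of_poly (cpoly N) $ n" .
qed

lemma tf_fps_mult:
  assumes "coeff D 0 \<noteq> 0"
  shows "tf_fps (W * N) D = fps_of_poly W * tf_fps N D"
  using assms by (simp add: tf_fps_def fps_divide_unit fps_of_poly_mult mult.assoc)

lemma cpoly_mult: "cpoly (p * q) = cpoly p * cpoly q"
  unfolding cpoly_def by (intro poly_eqI) (simp add: coeff_map_poly coeff_mult)

lemma stable_tf_mult:
  assumes "stable_tf N D"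
  shows "stable_tf (W * N) D"
proof -
  from assms obtain N' D' where *: "D \<noteq> 0" "cpoly N * D' = N' * cpoly D"
      "\<forall>w. cmod w \<le> 1 \<longrightarrow> poly D' w \<noteq> 0"
    unfolding stable_tf_def by blast
  then have "cpoly (W * N) * D' = (cpoly W * N') * cpoly D"
    by (simp add: cpoly_mult mult.assoc)
  with * show ?thesis
    unfolding stable_tf_def by blast
qed

text \<open>After cancelling \<open>D\<close>, the series is also the expansion of
  \<open>N' / D'\<close>, whose denominator has no zero in the closed unit disc. A polynomial has
  finitely many zeros, so a slightly larger disc is free of them too.\<close>

lemma stable_tf_radius:
  assumes D0: "coeff D 0 \<noteq> 0" and st: "stable_tf N D"
  shows "1 < conv_radius (\<lambda>k. complex_of_real (tf_fps N D $ k))"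
proof -
  define h where "h = Abs_fps (\<lambda>k. complex_of_real (tf_fps N D $ k))"
  from st obtain N' D' where D: "D \<noteq> 0" and eq: "cpoly N * D' = N' * cpoly D"
      and nz: "\<And>w. cmod w \<le> 1 \<Longrightarrow> poly D' w \<noteq> 0"
    unfolding stable_tf_def by blast
  have "h * fps_of_poly (cpoly D) = fps_of_poly (cpoly N)"
    unfolding h_def using D0 by (rule complex_tf_fps_mult_den)
  then have "h * fps_of_poly D' * fps_of_poly (cpoly D) = fps_of_poly N' * fps_of_poly (cpoly D)"
    by (metis eq fps_of_poly_mult mult.assoc mult.commute)
  moreover have "cpoly D \<noteq> 0"
    using D0 by (auto simp: cpoly_def poly_eq_iff coeff_map_poly intro!: exI[of _ 0])
  then have "fps_of_poly (cpoly D) \<noteq> 0"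
    by simp
  ultimately have "h * fps_of_poly D' = fps_of_poly N'"
    by simp
  moreover have D'0: "fps_of_poly D' $ 0 \<noteq> 0"
    using nz[of 0] by (simp add: poly_0_coeff_0)
  then have "fps_of_poly D' \<noteq> 0"
    by auto
  ultimately have h: "h = fps_of_poly N' / fps_of_poly D'"
    by (metis nonzero_mult_div_cancel_right)
  have "D' \<noteq> 0"
    using nz[of 0] by auto
  \<comment> \<open>The element 2 keeps the set nonempty when \<open>D'\<close> has no zeros; any
    number above 1 would serve.\<close>
  define r where "r = Min (insert 2 (cmod ` {w. poly D' w = 0}))"
  have fin: "finite {w. poly D' w = 0}"
    using \<open>D' \<noteq> 0\<close> by (rule poly_roots_finite)
  have r1: "1 < r"
    unfolding r_def using fin nz by (subst Min_gr_iff) (auto simp: not_le[symmetric])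
  have nz': "poly D' w \<noteq> 0" if "cmod w < r" for w
    using that fin unfolding r_def by auto
  have "1 < ereal r"
    using r1 by simp
  also have "ereal r \<le> fps_conv_radius h"
  proof -
    have "Min {ereal r, fps_conv_radius (fps_of_poly N'), fps_conv_radius (fps_of_poly D')}
        \<le> fps_conv_radius (fps_of_poly N' / fps_of_poly D')"
      using nz' r1 by (intro fps_conv_radius_divide') auto
    then show ?thesis
      by (simp add: h)
  qed
  finally show ?thesis
    by (simp add: fps_conv_radius_def h_def)
qed

text \<open>A radius of convergence above 1 makes the impulse response absolutely summable and lets
  the series represent the quotient on the unit circle, up to finitely many angles, which form a
  negligible set.\<close>

lemma stable_tf_parseval:
  assumes D0: "coeff D 0 \<noteq> 0" and st: "stable_tf N D"
  shows "summable (\<lambda>k. \<bar>tf_fps N D $ k\<bar>)"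
    and "summable (\<lambda>k. (tf_fps N D $ k)\<^sup>2)"
    and "((\<lambda>\<theta>. (cmod (evz N (cis \<theta>) / evz D (cis \<theta>)))\<^sup>2)
      has_integral 2 * pi * (\<Sum>k. (tf_fps N D $ k)\<^sup>2)) {-pi..pi}"
proof -
  let ?g = "\<lambda>k. tf_fps N D $ k"
  define h where "h = Abs_fps (\<lambda>k. complex_of_real (?g k))"
  have rad: "1 < fps_conv_radius h"
    using stable_tf_radius[OF assms] by (simp add: fps_conv_radius_def h_def)
  show abs: "summable (\<lambda>k. \<bar>?g k\<bar>)"
    using abs_summable_in_conv_radius[of 1 "\<lambda>k. complex_of_real (?g k)"]
      stable_tf_radius[OF assms] by (simp add: one_ereal_def)
  show "summable (\<lambda>k. (?g k)\<^sup>2)"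
    using abs by (rule parseval_power_series)
  have hD: "h * fps_of_poly (cpoly D) = fps_of_poly (cpoly N)"
    unfolding h_def using D0 by (rule complex_tf_fps_mult_den)
  \<comment> \<open>The denominator may still vanish on the unit circle where it has a common zero with the
    numerator; there the quotient has the junk value 0.\<close>
  define S where "S = {\<theta> \<in> {-pi..pi}. cis \<theta> \<in> inverse ` {w. poly (cpoly D) w = 0}}"
  have "cpoly D \<noteq> 0"
    using D0 by (auto simp: cpoly_def poly_eq_iff coeff_map_poly intro!: exI[of _ 0])
  then have "finite S"
    unfolding S_def by (intro finite_cis_preimage finite_imageI poly_roots_finite)
  have eval: "evz N (cis \<theta>) / evz D (cis \<theta>) = (\<Sum>k. of_real (?g k) * inverse (cis \<theta>) ^ k)"
    if "\<theta> \<in> {-pi..pi} - S" for \<theta>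
  proof -
    let ?w = "inverse (cis \<theta>)"
    have w: "cmod ?w = 1"
      by (simp add: norm_inverse)
    have "poly (cpoly D) ?w \<noteq> 0"
    proof
      assume "poly (cpoly D) ?w = 0"
      then have "cis \<theta> \<in> inverse ` {w. poly (cpoly D) w = 0}"
        by (intro image_eqI[of _ _ ?w]) auto
      with that show False
        by (auto simp: S_def)
    qed
    moreover have "eval_fps h ?w * poly (cpoly D) ?w = poly (cpoly N) ?w"
      using eval_fps_mult[of ?w h "fps_of_poly (cpoly D)"] rad w
      by (simp add: hD one_ereal_def)
    ultimately show ?thesis
      by (simp add: evz_def eval_fps_def h_def nonzero_divide_eq_eq)
  qed
  show "((\<lambda>\<theta>. (cmod (evz N (cis \<theta>) / evz D (cis \<theta>)))\<^sup>2)
      has_integral 2 * pi * (\<Sum>k. (?g k)\<^sup>2)) {-pi..pi}"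
    by (rule has_integral_spike[OF negligible_finite[OF \<open>finite S\<close>] _ parseval_power_series(2)[OF abs]])
      (simp only: eval)
qed

section \<open>Variance of the random channel and the spectral factor\<close>

text \<open>The covariance identity: the mean of a product of centered variables is half the mean of
  the product of their differences from an independent copy. Both sides expand to
  \<open>c - ma * mb\<close>.\<close>

lemma sum_weighted_centered_product:
  fixes a b q :: "nat \<Rightarrow> complex"
  assumes q: "(\<Sum>i\<le>T. q i) = 1"
  defines "ma \<equiv> \<Sum>i\<le>T. q i * a i" and "mb \<equiv> \<Sum>i\<le>T. q i * b i"
  shows "(\<Sum>t\<le>T. q t * ((a t - ma) * (b t - mb))) =
    1 / 2 * (\<Sum>i\<le>T. \<Sum>l\<le>T. (a i - a l) * (b i - b l) * (q i * q l))"
proof -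
  define c where "c = (\<Sum>t\<le>T. q t * (a t * b t))"
  have "(\<Sum>t\<le>T. q t * ((a t - ma) * (b t - mb))) =
      (\<Sum>t\<le>T. q t * (a t * b t) - q t * a t * mb - ma * (q t * b t) + q t * (ma * mb))"
    by (intro sum.cong) (auto simp: algebra_simps)
  also have "\<dots> = c - ma * mb - ma * mb + 1 * (ma * mb)"
    unfolding sum.distrib sum_subtractf c_def
    by (simp add: sum_distrib_left[symmetric] sum_distrib_right[symmetric] q
        flip: ma_def mb_def)
  finally have lhs: "(\<Sum>t\<le>T. q t * ((a t - ma) * (b t - mb))) = c - ma * mb"
    by simp
  have "(\<Sum>i\<le>T. \<Sum>l\<le>T. (a i - a l) * (b i - b l) * (q i * q l)) =
      (\<Sum>i\<le>T. \<Sum>l\<le>T. q i * (a i * b i) * q l - (q i * a i) * (q l * b l)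
        - (q i * b i) * (q l * a l) + q i * (q l * (a l * b l)))"
    by (intro sum.cong) (auto simp: algebra_simps)
  also have "\<dots> = c * 1 - ma * mb - mb * ma + 1 * c"
    unfolding sum.distrib sum_subtractf c_def ma_def mb_def sum_product q[symmetric] by simp
  finally show ?thesis
    unfolding lhs by simp
qed

text \<open>The deviation from the mean channel caused by a sample that meets delay
  \<open>t\<close>: the coefficient of \<open>z^-i\<close> weights the effect of that sample
  \<open>i\<close> steps after it was sent.\<close>

definition dev_poly :: "nat \<Rightarrow> (nat \<Rightarrow> real) \<Rightarrow> (nat \<Rightarrow> real) \<Rightarrow> nat \<Rightarrow> real poly" where
  "dev_poly T \<alpha> p t = (\<Sum>i\<le>T. monom (\<alpha> i * ((if t = i then 1 else 0) - p i)) i)"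

lemma coeff_dev_poly:
  "coeff (dev_poly T \<alpha> p t) i = (if i \<le> T then \<alpha> i * ((if t = i then 1 else 0) - p i) else 0)"
proof -
  have "coeff (dev_poly T \<alpha> p t) i =
      (\<Sum>j\<le>T. if j = i then \<alpha> i * ((if t = i then 1 else 0) - p i) else 0)"
    unfolding dev_poly_def coeff_sum coeff_monom by (intro sum.cong) auto
  then show ?thesis
    by simp
qed

lemma poly_cpoly_dev_poly:
  assumes "t \<le> T"
  shows "poly (cpoly (dev_poly T \<alpha> p t)) w =
    of_real (\<alpha> t) * w ^ t - (\<Sum>i\<le>T. of_real (p i) * (of_real (\<alpha> i) * w ^ i))"
proof -
  have "cpoly (dev_poly T \<alpha> p t) =
      (\<Sum>i\<le>T. monom (of_real (\<alpha> i * ((if t = i then 1 else 0) - p i))) i)"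
    unfolding cpoly_def dev_poly_def
    by (intro poly_eqI) (simp add: coeff_map_poly coeff_sum if_distrib cong: if_cong)
  then have "poly (cpoly (dev_poly T \<alpha> p t)) w =
      (\<Sum>i\<le>T. of_real (\<alpha> i * ((if t = i then 1 else 0) - p i)) * w ^ i)"
    by (simp add: poly_sum poly_monom)
  also have "\<dots> = (\<Sum>i\<le>T. (if i = t then of_real (\<alpha> t) * w ^ t else 0)
      - of_real (p i) * (of_real (\<alpha> i) * w ^ i))"
    by (intro sum.cong) (auto simp: algebra_simps)
  also have "\<dots> = of_real (\<alpha> t) * w ^ t - (\<Sum>i\<le>T. of_real (p i) * (of_real (\<alpha> i) * w ^ i))"
    using assms by (simp add: sum_subtractf)
  finally show ?thesis .
qed

lemma cnj_poly_cpoly: "cnj (poly (cpoly q) w) = poly (cpoly q) (cnj w)"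
  by (simp add: cpoly_def poly_altdef coeff_map_poly degree_map_poly)

text \<open>On the unit circle \<open>inverse z\<close> is the conjugate of \<open>z\<close>, so the
  left side is the variance of the random value \<alpha>(t) z^t under the weights \<open>p\<close>.
  The covariance identity turns it into the double sum that defines the spectral factor.\<close>

lemma spectral_factor_cmod:
  assumes sf: "spectral_factor T \<alpha> p \<Phi>" and p: "(\<Sum>i\<le>T. p i) = 1" and z: "cmod z = 1"
  shows "(\<Sum>t\<le>T. p t * (cmod (evz (dev_poly T \<alpha> p t) z))\<^sup>2) = (cmod (evz \<Phi> z))\<^sup>2"
proof -
  have z0: "z \<noteq> 0"
    using z by auto
  have inv: "inverse z = cnj z"
    using z divide_conv_cnj[of z 1] by (simp add: inverse_eq_divide)
  let ?a = "\<lambda>i. of_real (\<alpha> i) * z ^ i" and ?b = "\<lambda>i. of_real (\<alpha> i) * inverse z ^ i"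
  let ?q = "\<lambda>i. complex_of_real (p i)"
  have norm_sq: "complex_of_real ((cmod (evz q z))\<^sup>2) =
      poly (cpoly q) z * poly (cpoly q) (inverse z)" for q
    unfolding complex_norm_square evz_def by (simp add: cnj_poly_cpoly inv mult.commute)
  have q1: "(\<Sum>i\<le>T. ?q i) = 1"
    using arg_cong[OF p, of complex_of_real] by simp
  have "complex_of_real (\<Sum>t\<le>T. p t * (cmod (evz (dev_poly T \<alpha> p t) z))\<^sup>2) =
      (\<Sum>t\<le>T. ?q t * (poly (cpoly (dev_poly T \<alpha> p t)) z
        * poly (cpoly (dev_poly T \<alpha> p t)) (inverse z)))"
    by (simp only: of_real_sum of_real_mult norm_sq)
  also have "\<dots> = (\<Sum>t\<le>T. ?q t * ((?a t - (\<Sum>i\<le>T. ?q i * ?a i)) * (?b t - (\<Sum>i\<le>T. ?q i * ?b i))))"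
    by (intro sum.cong refl) (simp only: atMost_iff poly_cpoly_dev_poly)
  also have "\<dots> = 1 / 2 * (\<Sum>i\<le>T. \<Sum>l\<le>T. (?a i - ?a l) * (?b i - ?b l) * (?q i * ?q l))"
    by (rule sum_weighted_centered_product[OF q1])
  also have "\<dots> = poly (cpoly \<Phi>) z * poly (cpoly \<Phi>) (inverse z)"
    using spec[OF conjunct2[OF conjunct2[OF sf[unfolded spectral_factor_def]]], of z] z0
    by (simp only: of_real_mult not_False_eq_True simp_thms)
  also have "\<dots> = complex_of_real ((cmod (evz \<Phi> z))\<^sup>2)"
    by (rule norm_sq[symmetric])
  finally show ?thesis
    by (simp only: of_real_eq_iff)
qed

lemma h2sq_tf:
  assumes "coeff D 0 \<noteq> 0" and "stable_tf N D"
  shows "h2sq (\<lambda>z. evz N z / evz D z) = (\<Sum>k. (tf_fps N D $ k)\<^sup>2)"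
  unfolding h2sq_def integral_unique[OF stable_tf_parseval(3)[OF assms]] by simp

text \<open>Parseval is applied to the response for each delay value and the results are averaged
  with the weights \<open>p\<close>. Pointwise on the circle, the averaged square of the deviation
  is that of \<open>\<Phi>\<close>.\<close>

lemma h2sq_spectral_factor:
  assumes D0: "coeff D 0 \<noteq> 0" and st: "stable_tf N D"
    and sf: "spectral_factor T \<alpha> p \<Phi>" and p: "(\<Sum>i\<le>T. p i) = 1"
  shows "summable (\<lambda>k. \<Sum>t\<le>T. p t * (tf_fps (dev_poly T \<alpha> p t * N) D $ k)\<^sup>2)"
    and "h2sq (\<lambda>z. evz \<Phi> z * (evz N z / evz D z)) =
      (\<Sum>k. \<Sum>t\<le>T. p t * (tf_fps (dev_poly T \<alpha> p t * N) D $ k)\<^sup>2)"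
proof -
  let ?W = "dev_poly T \<alpha> p"
  note st' = stable_tf_mult[OF st]
  note summ = stable_tf_parseval(2)[OF D0 st']
  show "summable (\<lambda>k. \<Sum>t\<le>T. p t * (tf_fps (?W t * N) D $ k)\<^sup>2)"
    by (intro summable_sum summable_mult summ)
  have "((\<lambda>\<theta>. \<Sum>t\<le>T. p t * (cmod (evz (?W t * N) (cis \<theta>) / evz D (cis \<theta>)))\<^sup>2)
      has_integral (\<Sum>t\<le>T. p t * (2 * pi * (\<Sum>k. (tf_fps (?W t * N) D $ k)\<^sup>2)))) {-pi..pi}"
    by (intro has_integral_sum has_integral_mult_right stable_tf_parseval(3)[OF D0 st']) auto
  moreover have "(\<Sum>t\<le>T. p t * (cmod (evz (?W t * N) (cis \<theta>) / evz D (cis \<theta>)))\<^sup>2) =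
      (cmod (evz \<Phi> (cis \<theta>) * (evz N (cis \<theta>) / evz D (cis \<theta>))))\<^sup>2" for \<theta>
  proof -
    have "(cmod (evz (?W t * N) (cis \<theta>) / evz D (cis \<theta>)))\<^sup>2 =
        (cmod (evz (?W t) (cis \<theta>)))\<^sup>2 * (cmod (evz N (cis \<theta>) / evz D (cis \<theta>)))\<^sup>2" for t
      by (simp add: evz_def cpoly_mult norm_mult norm_divide power_mult_distrib power_divide)
    then have "(\<Sum>t\<le>T. p t * (cmod (evz (?W t * N) (cis \<theta>) / evz D (cis \<theta>)))\<^sup>2) =
        (\<Sum>t\<le>T. p t * (cmod (evz (?W t) (cis \<theta>)))\<^sup>2) * (cmod (evz N (cis \<theta>) / evz D (cis \<theta>)))\<^sup>2"
      by (simp only: sum_distrib_right mult.assoc)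
    also have "\<dots> = (cmod (evz \<Phi> (cis \<theta>) * (evz N (cis \<theta>) / evz D (cis \<theta>))))\<^sup>2"
      by (simp only: spectral_factor_cmod[OF sf p norm_cis] norm_mult power_mult_distrib)
    finally show ?thesis .
  qed
  moreover have "(\<Sum>t\<le>T. p t * (2 * pi * (\<Sum>k. (tf_fps (?W t * N) D $ k)\<^sup>2))) =
      2 * pi * (\<Sum>k. \<Sum>t\<le>T. p t * (tf_fps (?W t * N) D $ k)\<^sup>2)"
  proof -
    have "(\<Sum>k. \<Sum>t\<le>T. p t * (tf_fps (?W t * N) D $ k)\<^sup>2) =
        (\<Sum>t\<le>T. \<Sum>k. p t * (tf_fps (?W t * N) D $ k)\<^sup>2)"
      by (intro suminf_sum summable_mult summ)
    also have "\<dots> = (\<Sum>t\<le>T. p t * (\<Sum>k. (tf_fps (?W t * N) D $ k)\<^sup>2))"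
      by (intro sum.cong refl suminf_mult summ)
    finally show ?thesis
      by (simp add: sum_distrib_left algebra_simps)
  qed
  ultimately have "((\<lambda>\<theta>. (cmod (evz \<Phi> (cis \<theta>) * (evz N (cis \<theta>) / evz D (cis \<theta>))))\<^sup>2)
      has_integral 2 * pi * (\<Sum>k. \<Sum>t\<le>T. p t * (tf_fps (?W t * N) D $ k)\<^sup>2)) {-pi..pi}"
    by (simp only:)
  from integral_unique[OF this]
  show "h2sq (\<lambda>z. evz \<Phi> z * (evz N z / evz D z)) =
      (\<Sum>k. \<Sum>t\<le>T. p t * (tf_fps (?W t * N) D $ k)\<^sup>2)"
    unfolding h2sq_def by simp
qed

subsection \<open>The closed loop as a recursion\<close>

text \<open>The control signal for one input path \<open>a\<close> and one delay path
  \<open>t\<close>: \<open>g\<close> is the impulse response of the nominal loop, and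
  \<open>C i m\<close> is the response at lag \<open>m\<close> to a unit control sample that met
  delay \<open>i\<close>.\<close>

fun loop_resp :: "(nat \<Rightarrow> real) \<Rightarrow> (nat \<Rightarrow> nat \<Rightarrow> real) \<Rightarrow> (nat \<Rightarrow> real) \<Rightarrow> (nat \<Rightarrow> nat) \<Rightarrow>
    nat \<Rightarrow> real" where
  "loop_resp g C a t k =
    (\<Sum>j\<le>k. g j * a (k - j)) - (\<Sum>n<k. loop_resp g C a t n * C (t n) (k - n))"

declare loop_resp.simps [simp del]

lemma loop_resp_unique:
  assumes "\<And>k. u k = (\<Sum>j\<le>k. g j * a (k - j)) - (\<Sum>n<k. u n * C (t n) (k - n))"
  shows "u k = loop_resp g C a t k"
proof (induction k rule: less_induct)
  case (less k)
  then have "(\<Sum>n<k. u n * C (t n) (k - n)) = (\<Sum>n<k. loop_resp g C a t n * C (t n) (k - n))"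
    by (intro sum.cong) auto
  then show ?case
    using assms[of k] by (subst loop_resp.simps) simp
qed

text \<open>Strict causality: the control at time \<open>k\<close> sees only delays before
  \<open>k\<close>. This is the source of the independence of \<open>u(k)\<close> and the delay at
  time \<open>k\<close>.\<close>

lemma loop_resp_cong:
  assumes "\<And>n. n < k \<Longrightarrow> t n = t' n"
  shows "loop_resp g C a t k = loop_resp g C a t' k"
  using assms
proof (induction k rule: less_induct)
  case (less k)
  have "(\<Sum>n<k. loop_resp g C a t n * C (t n) (k - n)) =
      (\<Sum>n<k. loop_resp g C a t' n * C (t' n) (k - n))"
    using less by (intro sum.cong) auto
  then show ?case
    by (simp add: loop_resp.simps[of _ _ _ _ k])
qed

text \<open>Rest before time 0 turns a difference equation into a product of formal power series.
  The range is first enlarged to \<open>degree P + k\<close>, where both summation bounds fit, and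
  then cut at \<open>k\<close>.\<close>

lemma sum_coeff_sig:
  "(\<Sum>i\<le>degree P. coeff P i * sig x k i) = (fps_of_poly P * Abs_fps x) $ k"
proof -
  let ?h = "\<lambda>i. coeff P i * sig x k i"
  have "(\<Sum>i\<le>degree P. ?h i) = (\<Sum>i\<le>degree P + k. ?h i)"
    by (intro sum.mono_neutral_left) (auto simp: coeff_eq_0)
  also have "\<dots> = (\<Sum>i\<le>k. ?h i)"
    by (intro sum.mono_neutral_right) (auto simp: sig_def)
  also have "\<dots> = (fps_of_poly P * Abs_fps x) $ k"
    by (simp add: fps_mult_nth atLeast0AtMost sig_def)
  finally show ?thesis .
qed

lemma dist_sig_eq:
  "dist_sig T \<alpha> p t u k = (\<Sum>i\<le>k. coeff (dev_poly T \<alpha> p (t (k - i))) i * u (k - i))"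
proof -
  let ?h = "\<lambda>i. if i \<le> k then coeff (dev_poly T \<alpha> p (t (k - i))) i * u (k - i) else 0"
  have "dist_sig T \<alpha> p t u k = (\<Sum>i\<le>T. ?h i)"
    unfolding dist_sig_def by (intro sum.cong) (auto simp: coeff_dev_poly)
  also have "\<dots> = (\<Sum>i\<le>T + k. ?h i)"
    by (intro sum.mono_neutral_left) (auto simp: coeff_dev_poly)
  also have "\<dots> = (\<Sum>i\<le>k. ?h i)"
    by (intro sum.mono_neutral_right) auto
  finally show ?thesis
    by simp
qed

lemma coeff_mean_chan: "coeff (mean_chan T \<alpha> p) i = (if i \<le> T then \<alpha> i * p i else 0)"
proof -
  have "coeff (mean_chan T \<alpha> p) i = (\<Sum>j\<le>T. if j = i then \<alpha> i * p i else 0)"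
    unfolding mean_chan_def coeff_sum coeff_monom by (intro sum.cong) auto
  then show ?thesis
    by simp
qed

text \<open>Splits the random channel into mean channel and disturbance. The left side does not
  mention \<open>p\<close>, hence the explicit instantiations where the equation is applied.\<close>

lemma chan_out_eq:
  "Abs_fps (chan_out T \<alpha> t u) =
    fps_of_poly (mean_chan T \<alpha> p) * Abs_fps u + Abs_fps (dist_sig T \<alpha> p t u)"
proof (rule fps_ext)
  fix k
  let ?h = "\<lambda>i. if i \<le> k then coeff (mean_chan T \<alpha> p) i * u (k - i) else 0"
  have "(fps_of_poly (mean_chan T \<alpha> p) * Abs_fps u) $ k = (\<Sum>i\<le>k. ?h i)"
    by (simp add: fps_mult_nth atLeast0AtMost)
  also have "\<dots> = (\<Sum>i\<le>T + k. ?h i)"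
    by (intro sum.mono_neutral_left) auto
  also have "\<dots> = (\<Sum>i\<le>T. ?h i)"
    by (intro sum.mono_neutral_right) (auto simp: coeff_mean_chan)
  finally have mean: "(fps_of_poly (mean_chan T \<alpha> p) * Abs_fps u) $ k = (\<Sum>i\<le>T. ?h i)" .
  show "Abs_fps (chan_out T \<alpha> t u) $ k =
      (fps_of_poly (mean_chan T \<alpha> p) * Abs_fps u + Abs_fps (dist_sig T \<alpha> p t u)) $ k"
    unfolding fps_add_nth mean fps_nth_Abs_fps chan_out_def dist_sig_def sum.distrib[symmetric]
    by (intro sum.cong) (auto simp: coeff_mean_chan algebra_simps)
qed

text \<open>The response to the disturbance is regrouped by the time \<open>n\<close> at which a
  sample was sent. This exchanges a triangular double sum over sending time and channel lag; the
  inner sum is the convolution of the deviation polynomial with the impulse response.\<close>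

lemma tf_fps_dist_sig:
  assumes D0: "coeff D 0 \<noteq> 0"
  shows "(tf_fps N D * Abs_fps (dist_sig T \<alpha> p t u)) $ k =
    (\<Sum>n\<le>k. u n * tf_fps (dev_poly T \<alpha> p (t n) * N) D $ (k - n))"
proof -
  let ?w = "\<lambda>n i. coeff (dev_poly T \<alpha> p (t n)) i"
  let ?f = "\<lambda>n i. ?w n i * u n * tf_fps N D $ (k - (n + i))"
  have "(tf_fps N D * Abs_fps (dist_sig T \<alpha> p t u)) $ k =
      (Abs_fps (dist_sig T \<alpha> p t u) * tf_fps N D) $ k"
    by (simp add: mult.commute)
  also have "\<dots> = (\<Sum>j\<le>k. \<Sum>i\<le>j. ?f (j - i) i)"
    by (simp add: fps_mult_nth atLeast0AtMost dist_sig_eq sum_distrib_right)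
  also have "\<dots> = (\<Sum>(i, n)\<in>{(i, n). i + n \<le> k}. ?f n i)"
    by (rule sum.triangle_reindex_eq[symmetric])
  also have "\<dots> = (\<Sum>(n, i)\<in>Sigma {..k} (\<lambda>n. {..k - n}). ?f n i)"
    by (rule sum.reindex_bij_witness[of _ "\<lambda>(n, i). (i, n)" "\<lambda>(i, n). (n, i)"]) auto
  also have "\<dots> = (\<Sum>n\<le>k. \<Sum>i\<le>k - n. ?f n i)"
    by (rule sum.Sigma[symmetric]) auto
  also have "\<dots> = (\<Sum>n\<le>k. u n * tf_fps (dev_poly T \<alpha> p (t n) * N) D $ (k - n))"
    unfolding tf_fps_mult[OF D0] fps_mult_nth atLeast0AtMost
    by (intro sum.cong refl) (auto simp: sum_distrib_left intro!: sum.cong)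
  finally show ?thesis .
qed

text \<open>Strict properness, \<open>coeff N 0 = 0\<close>, gives every response \<open>C i\<close>
  the value 0 at lag 0. The term \<open>n = k\<close> therefore vanishes, and the implicit equation
  \<open>u = G (v - d)\<close> becomes an explicit recursion.\<close>

lemma loop_resp_iff:
  assumes D0: "coeff D 0 \<noteq> 0" and N0: "coeff N 0 = 0"
  shows "Abs_fps u = tf_fps N D * (Abs_fps v - Abs_fps (dist_sig T \<alpha> p t u)) \<longleftrightarrow>
    u = loop_resp (\<lambda>k. tf_fps N D $ k) (\<lambda>i m. tf_fps (dev_poly T \<alpha> p i * N) D $ m) v t"
    (is "?L \<longleftrightarrow> u = loop_resp ?g ?C v t")
proof -
  have C0: "?C i 0 = 0" for i
    using N0 D0 by (simp add: tf_fps_def fps_divide_unit coeff_mult)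
  have rhs: "(tf_fps N D * (Abs_fps v - Abs_fps (dist_sig T \<alpha> p t u))) $ k =
      (\<Sum>j\<le>k. ?g j * v (k - j)) - (\<Sum>n<k. u n * ?C (t n) (k - n))" for k
    unfolding right_diff_distrib fps_sub_nth tf_fps_dist_sig[OF D0]
    by (simp add: fps_mult_nth atLeast0AtMost C0 flip: lessThan_Suc_atMost)
  have "?L \<longleftrightarrow> (\<forall>k. u k = (\<Sum>j\<le>k. ?g j * v (k - j)) - (\<Sum>n<k. u n * ?C (t n) (k - n)))"
    unfolding fps_eq_iff rhs fps_nth_Abs_fps ..
  also have "\<dots> \<longleftrightarrow> u = loop_resp ?g ?C v t"
  proof
    assume "\<forall>k. u k = (\<Sum>j\<le>k. ?g j * v (k - j)) - (\<Sum>n<k. u n * ?C (t n) (k - n))"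
    then show "u = loop_resp ?g ?C v t"
      by (intro ext loop_resp_unique) blast
  next
    assume u: "u = loop_resp ?g ?C v t"
    show "\<forall>k. u k = (\<Sum>j\<le>k. ?g j * v (k - j)) - (\<Sum>n<k. u n * ?C (t n) (k - n))"
      unfolding u by (intro allI loop_resp.simps)
  qed
  finally show ?thesis .
qed

section \<open>From the loop equations to the recursion\<close>

lemma loop_eqs_fps:
  "loop_eqs Pn Pd Kn Kd T \<alpha> v t y u ud \<longleftrightarrow>
    ud = chan_out T \<alpha> t u \<and>
    fps_of_poly Pd * Abs_fps y = fps_of_poly Pn * (Abs_fps v - Abs_fps ud) \<and>
    fps_of_poly Kd * Abs_fps u = fps_of_poly Kn * Abs_fps y"
proof -
  have diff: "Abs_fps (\<lambda>j. v j - ud j) = Abs_fps v - Abs_fps ud"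
    by (rule fps_ext) simp
  show ?thesis
    unfolding loop_eqs_def sum_coeff_sig diff by (simp only: fps_eq_iff fun_eq_iff)
qed

text \<open>Well-posedness of the nominal loop: the feedback term vanishes at \<open>w = 0\<close>
  together with \<open>coeff Pn 0\<close>.\<close>

lemma coeff_0_G_den:
  assumes "coeff Pd 0 \<noteq> 0" "coeff Pn 0 = 0" "coeff Kd 0 \<noteq> 0"
  shows "coeff (G_den Pn Pd Kn Kd T \<alpha> p) 0 \<noteq> 0"
  using assms by (simp add: G_den_def coeff_mult)

lemma fps_of_poly_G_den:
  "fps_of_poly (G_den Pn Pd Kn Kd T \<alpha> p) = fps_of_poly Pd * fps_of_poly Kd
    + fps_of_poly Pn * fps_of_poly Kn * fps_of_poly (mean_chan T \<alpha> p)"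
  by (simp add: G_den_def fps_of_poly_add fps_of_poly_mult)

text \<open>Multiplying the controller equation by \<open>Pd\<close> eliminates \<open>y\<close>.
  The mean channel then moves to the left side, which gives \<open>D u = N (v - d)\<close>, and
  \<open>D\<close> can be cancelled.\<close>

lemma loop_eqs_unique:
  fixes p :: "nat \<Rightarrow> real"
  assumes "coeff Pd 0 \<noteq> 0" "coeff Pn 0 = 0" "coeff Kd 0 \<noteq> 0"
    and loop: "loop_eqs Pn Pd Kn Kd T \<alpha> v t y u ud"
  defines "N \<equiv> G_num Pn Pd Kn Kd" and "D \<equiv> G_den Pn Pd Kn Kd T \<alpha> p"
  shows "u = loop_resp (\<lambda>k. tf_fps N D $ k) (\<lambda>i m. tf_fps (dev_poly T \<alpha> p i * N) D $ m) v t"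
proof -
  have D0: "coeff D 0 \<noteq> 0"
    unfolding D_def by (rule coeff_0_G_den) fact+
  have N0: "coeff N 0 = 0"
    using assms by (simp add: G_num_def coeff_mult)
  define U V d H where "U = Abs_fps u" and "V = Abs_fps v"
    and "d = Abs_fps (dist_sig T \<alpha> p t u)" and "H = fps_of_poly (mean_chan T \<alpha> p)"
  from loop have plant: "fps_of_poly Pd * Abs_fps y = fps_of_poly Pn * (V - (H * U + d))"
    and controller: "fps_of_poly Kd * U = fps_of_poly Kn * Abs_fps y"
    unfolding loop_eqs_fps by (simp_all add: chan_out_eq[of _ _ _ _ p] U_def V_def d_def H_def)
  have "fps_of_poly Pd * (fps_of_poly Kd * U) = fps_of_poly Kn * (fps_of_poly Pd * Abs_fps y)"
    unfolding controller by (simp add: ac_simps)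
  then have "fps_of_poly D * U = fps_of_poly N * (V - d)"
    unfolding plant D_def N_def G_num_def fps_of_poly_G_den H_def[symmetric]
    by (simp add: fps_of_poly_mult algebra_simps)
  also have "\<dots> = fps_of_poly D * (tf_fps N D * (V - d))"
    unfolding tf_fps_mult_den[OF D0, of N, symmetric] by (simp add: ac_simps)
  finally have "fps_of_poly D * U = fps_of_poly D * (tf_fps N D * (V - d))" .
  moreover have "fps_of_poly D \<noteq> 0"
    using D0 by auto
  ultimately have "U = tf_fps N D * (V - d)"
    by simp
  then show ?thesis
    unfolding U_def V_def d_def loop_resp_iff[OF D0 N0] .
qed

text \<open>The stability hypothesis bounds only actual solutions of the loop, so one has to be
  exhibited. The plant equation defines \<open>Y\<close>; the controller equation follows from
  \<open>D u = N (v - d)\<close> after cancelling \<open>Pd\<close>.\<close>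

lemma loop_eqs_exist:
  fixes Pn Pd Kn Kd :: "real poly" and T :: nat and \<alpha> p v :: "nat \<Rightarrow> real" and t :: "nat \<Rightarrow> nat"
  assumes "coeff Pd 0 \<noteq> 0" "coeff Pn 0 = 0" "coeff Kd 0 \<noteq> 0"
  defines "N \<equiv> G_num Pn Pd Kn Kd" and "D \<equiv> G_den Pn Pd Kn Kd T \<alpha> p"
  defines "u \<equiv> loop_resp (\<lambda>k. tf_fps N D $ k) (\<lambda>i m. tf_fps (dev_poly T \<alpha> p i * N) D $ m) v t"
  shows "\<exists>y. loop_eqs Pn Pd Kn Kd T \<alpha> v t y u (chan_out T \<alpha> t u)"
proof -
  have D0: "coeff D 0 \<noteq> 0"
    unfolding D_def by (rule coeff_0_G_den) fact+
  have N0: "coeff N 0 = 0"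
    using assms by (simp add: G_num_def coeff_mult)
  define U V d H where "U = Abs_fps u" and "V = Abs_fps v"
    and "d = Abs_fps (dist_sig T \<alpha> p t u)" and "H = fps_of_poly (mean_chan T \<alpha> p)"
  define Y where "Y = tf_fps Pn Pd * (V - (H * U + d))"
  have plant: "fps_of_poly Pd * Y = fps_of_poly Pn * (V - (H * U + d))"
    unfolding Y_def tf_fps_mult_den[OF assms(1), of Pn, symmetric] by (simp add: ac_simps)
  have "U = tf_fps N D * (V - d)"
    unfolding U_def V_def d_def loop_resp_iff[OF D0 N0] u_def ..
  then have "fps_of_poly D * U = fps_of_poly N * (V - d)"
    unfolding tf_fps_mult_den[OF D0, of N, symmetric] by (simp add: ac_simps)
  then have "fps_of_poly Pd * (fps_of_poly Kd * U) = fps_of_poly Kn * (fps_of_poly Pd * Y)"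
    unfolding plant D_def N_def G_num_def fps_of_poly_G_den H_def[symmetric]
    by (simp add: fps_of_poly_mult algebra_simps)
  then have "fps_of_poly Pd * (fps_of_poly Kd * U) = fps_of_poly Pd * (fps_of_poly Kn * Y)"
    by (simp add: ac_simps)
  moreover have "fps_of_poly Pd \<noteq> 0"
    using assms(1) by auto
  ultimately have controller: "fps_of_poly Kd * U = fps_of_poly Kn * Y"
    by simp
  have "loop_eqs Pn Pd Kn Kd T \<alpha> v t (\<lambda>k. Y $ k) u (chan_out T \<alpha> t u)"
    unfolding loop_eqs_fps chan_out_eq[of _ _ _ _ p]
    using plant controller by (simp add: U_def V_def d_def H_def fps_nth_inverse)
  then show ?thesis
    by blast
qed

text \<open>Each coefficient of the deviation polynomial averages to \<alpha>(i) (p(i) - p(i)) = 0,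
  and the response is linear in these coefficients.\<close>

lemma dev_response_mean_zero:
  assumes D0: "coeff D 0 \<noteq> 0" and p: "(\<Sum>i\<le>T. p i) = 1"
  shows "(\<Sum>t\<le>T. p t * tf_fps (dev_poly T \<alpha> p t * N) D $ m) = 0"
proof -
  have zero: "(\<Sum>t\<le>T. p t * coeff (dev_poly T \<alpha> p t) i) = 0" for i
  proof (cases "i \<le> T")
    case True
    have "(\<Sum>t\<le>T. p t * coeff (dev_poly T \<alpha> p t) i) =
        (\<Sum>t\<le>T. \<alpha> i * (if t = i then p i else 0) - p t * (\<alpha> i * p i))"
      using True by (intro sum.cong) (auto simp: coeff_dev_poly algebra_simps)
    also have "\<dots> = 0"
      using True p by (simp add: sum_subtractf sum_distrib_left[symmetric] sum_distrib_right[symmetric])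
    finally show ?thesis .
  qed (simp add: coeff_dev_poly)
  have "(\<Sum>t\<le>T. p t * tf_fps (dev_poly T \<alpha> p t * N) D $ m) =
      (\<Sum>t\<le>T. \<Sum>i\<le>m. p t * coeff (dev_poly T \<alpha> p t) i * tf_fps N D $ (m - i))"
    unfolding tf_fps_mult[OF D0] fps_mult_nth atLeast0AtMost by (simp add: sum_distrib_left mult.assoc)
  also have "\<dots> = (\<Sum>i\<le>m. (\<Sum>t\<le>T. p t * coeff (dev_poly T \<alpha> p t) i) * tf_fps N D $ (m - i))"
    by (subst sum.swap) (simp add: sum_distrib_right)
  finally show ?thesis
    by (simp add: zero)
qed

subsection \<open>Second moments under independent delays\<close>

definition (in prob_space) square_integrable :: "('a \<Rightarrow> real) \<Rightarrow> bool" where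
  "square_integrable f \<longleftrightarrow> random_variable borel f \<and> integrable M (\<lambda>\<omega>. (f \<omega>)\<^sup>2)"

context prob_space
begin

lemma square_integrable_mult:
  assumes "square_integrable f" "square_integrable g"
  shows "integrable M (\<lambda>\<omega>. f \<omega> * g \<omega>)"
proof (rule Bochner_Integration.integrable_bound)
  show "integrable M (\<lambda>\<omega>. (f \<omega>)\<^sup>2 + (g \<omega>)\<^sup>2)"
    using assms unfolding square_integrable_def by auto
  show "(\<lambda>\<omega>. f \<omega> * g \<omega>) \<in> borel_measurable M"
    using assms unfolding square_integrable_def by auto
  have "norm (f \<omega> * g \<omega>) \<le> norm ((f \<omega>)\<^sup>2 + (g \<omega>)\<^sup>2)" for \<omega>
  proof -
    have "2 * (\<bar>f \<omega>\<bar> * \<bar>g \<omega>\<bar>) \<le> (f \<omega>)\<^sup>2 + (g \<omega>)\<^sup>2"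
      using sum_squares_bound[of "\<bar>f \<omega>\<bar>" "\<bar>g \<omega>\<bar>"] by simp
    moreover have "0 \<le> \<bar>f \<omega>\<bar> * \<bar>g \<omega>\<bar>"
      by simp
    ultimately show ?thesis
      unfolding real_norm_def abs_mult by linarith
  qed
  then show "AE \<omega> in M. norm (f \<omega> * g \<omega>) \<le> norm ((f \<omega>)\<^sup>2 + (g \<omega>)\<^sup>2)"
    by simp
qed

lemma square_integrable_diff:
  assumes f: "square_integrable f" and g: "square_integrable g"
  shows "square_integrable (\<lambda>\<omega>. f \<omega> - g \<omega>)"
proof -
  have "integrable M (\<lambda>\<omega>. (f \<omega>)\<^sup>2 + (g \<omega>)\<^sup>2 - 2 * (f \<omega> * g \<omega>))"
    using square_integrable_mult[OF f g] f g unfolding square_integrable_def by auto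
  moreover have "(\<lambda>\<omega>. (f \<omega> - g \<omega>)\<^sup>2) = (\<lambda>\<omega>. (f \<omega>)\<^sup>2 + (g \<omega>)\<^sup>2 - 2 * (f \<omega> * g \<omega>))"
    by (simp add: power2_diff mult.assoc)
  ultimately show ?thesis
    using f g unfolding square_integrable_def by auto
qed

lemma square_integrable_add:
  assumes f: "square_integrable f" and g: "square_integrable g"
  shows "square_integrable (\<lambda>\<omega>. f \<omega> + g \<omega>)"
proof -
  have "integrable M (\<lambda>\<omega>. (f \<omega>)\<^sup>2 + (g \<omega>)\<^sup>2 + 2 * (f \<omega> * g \<omega>))"
    using square_integrable_mult[OF f g] f g unfolding square_integrable_def by auto
  moreover have "(\<lambda>\<omega>. (f \<omega> + g \<omega>)\<^sup>2) = (\<lambda>\<omega>. (f \<omega>)\<^sup>2 + (g \<omega>)\<^sup>2 + 2 * (f \<omega> * g \<omega>))"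
    by (simp add: power2_sum mult.assoc)
  ultimately show ?thesis
    using f g unfolding square_integrable_def by auto
qed

lemma square_integrable_cmult:
  assumes "square_integrable f"
  shows "square_integrable (\<lambda>\<omega>. c * f \<omega>)"
  using assms unfolding square_integrable_def by (auto simp: power_mult_distrib)

lemma square_integrable_sum:
  assumes "\<And>i. i \<in> I \<Longrightarrow> square_integrable (f i)"
  shows "square_integrable (\<lambda>\<omega>. \<Sum>i\<in>I. f i \<omega>)"
  using assms
proof (induction I rule: infinite_finite_induct)
  case (insert i I)
  then show ?case
    using square_integrable_add[of "f i" "\<lambda>\<omega>. \<Sum>i\<in>I. f i \<omega>"] by simp
qed (simp_all add: square_integrable_def)

lemma expectation_orthogonal_sum:
  assumes fin: "finite I" and f: "\<And>i. i \<in> I \<Longrightarrow> square_integrable (f i)"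
    and orth: "\<And>i j. i \<in> I \<Longrightarrow> j \<in> I \<Longrightarrow> i \<noteq> j \<Longrightarrow> expectation (\<lambda>\<omega>. f i \<omega> * f j \<omega>) = 0"
  shows "expectation (\<lambda>\<omega>. (\<Sum>i\<in>I. f i \<omega>)\<^sup>2) = (\<Sum>i\<in>I. expectation (\<lambda>\<omega>. (f i \<omega>)\<^sup>2))"
proof -
  have "expectation (\<lambda>\<omega>. (\<Sum>i\<in>I. f i \<omega>)\<^sup>2) =
      expectation (\<lambda>\<omega>. \<Sum>i\<in>I. \<Sum>j\<in>I. f i \<omega> * f j \<omega>)"
    by (simp only: power2_eq_square sum_product)
  also have "\<dots> = (\<Sum>i\<in>I. \<Sum>j\<in>I. expectation (\<lambda>\<omega>. f i \<omega> * f j \<omega>))"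
    using f by (simp add: Bochner_Integration.integral_sum square_integrable_mult)
  also have "\<dots> = (\<Sum>i\<in>I. \<Sum>j\<in>I. if j = i then expectation (\<lambda>\<omega>. (f i \<omega>)\<^sup>2) else 0)"
    using orth by (intro sum.cong refl) (auto simp: power2_eq_square)
  also have "\<dots> = (\<Sum>i\<in>I. expectation (\<lambda>\<omega>. (f i \<omega>)\<^sup>2))"
    using fin by simp
  finally show ?thesis .
qed

lemma expectation_orthogonal_diff:
  assumes f: "square_integrable f" and g: "square_integrable g"
    and orth: "expectation (\<lambda>\<omega>. f \<omega> * g \<omega>) = 0"
  shows "expectation (\<lambda>\<omega>. (f \<omega> - g \<omega>)\<^sup>2) =
    expectation (\<lambda>\<omega>. (f \<omega>)\<^sup>2) + expectation (\<lambda>\<omega>. (g \<omega>)\<^sup>2)"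
proof -
  have "(\<lambda>\<omega>. (f \<omega> - g \<omega>)\<^sup>2) = (\<lambda>\<omega>. (f \<omega>)\<^sup>2 + (g \<omega>)\<^sup>2 - 2 * (f \<omega> * g \<omega>))"
    by (simp add: power2_diff mult.assoc)
  then show ?thesis
    using square_integrable_mult[OF f g] f g orth unfolding square_integrable_def by simp
qed

section \<open>Independence extended from generating events\<close>

lemma Int_stable_vimage: "Int_stable {Z -` c \<inter> space M |c. c \<in> sets R}"
  unfolding Int_stable_def
proof (intro ballI)
  fix a b assume "a \<in> {Z -` c \<inter> space M |c. c \<in> sets R}" "b \<in> {Z -` c \<inter> space M |c. c \<in> sets R}"
  then obtain A B where *: "A \<in> sets R" "B \<in> sets R"
    "a = Z -` A \<inter> space M" "b = Z -` B \<inter> space M"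
    by blast
  then have "a \<inter> b = Z -` (A \<inter> B) \<inter> space M"
    by auto
  moreover have "A \<inter> B \<in> sets R"
    using * by auto
  ultimately show "a \<inter> b \<in> {Z -` c \<inter> space M |c. c \<in> sets R}"
    by blast
qed

text \<open>Preimages of rectangles form an intersection-stable generator of the events of the pair,
  so independence from \<open>Z\<close> extends from rectangles to every \<open>A\<close>. The
  product rule for \<open>X\<close> and \<open>Y\<close> alone is the case where the third event is
  the whole space.\<close>

lemma prob_pair_inter_eq_times:
  assumes [measurable]: "random_variable S X" "random_variable T1 Y" "random_variable T2 Z"
    and three: "\<And>a b c. a \<in> sets S \<Longrightarrow> b \<in> sets T1 \<Longrightarrow> c \<in> sets T2 \<Longrightarrow>
      prob ((X -` a \<inter> space M) \<inter> (Y -` b \<inter> space M) \<inter> (Z -` c \<inter> space M)) =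
      prob (X -` a \<inter> space M) * prob (Y -` b \<inter> space M) * prob (Z -` c \<inter> space M)"
    and A: "A \<in> sets (S \<Otimes>\<^sub>M T1)" and c: "c \<in> sets T2"
  shows "prob (((\<lambda>\<omega>. (X \<omega>, Y \<omega>)) -` A \<inter> space M) \<inter> (Z -` c \<inter> space M)) =
    prob ((\<lambda>\<omega>. (X \<omega>, Y \<omega>)) -` A \<inter> space M) * prob (Z -` c \<inter> space M)"
proof -
  let ?XY = "\<lambda>\<omega>. (X \<omega>, Y \<omega>)"
  have rv: "random_variable (S \<Otimes>\<^sub>M T1) ?XY"
    by measurable
  define R where "R = {?XY -` A \<inter> space M |A. A \<in> {a \<times> b |a b. a \<in> sets S \<and> b \<in> sets T1}}"
  define Q where "Q = {Z -` c \<inter> space M |c. c \<in> sets T2}"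
  have rect: "?XY -` (a \<times> b) \<inter> space M = (X -` a \<inter> space M) \<inter> (Y -` b \<inter> space M)" for a b
    by auto
  have two: "prob (?XY -` (a \<times> b) \<inter> space M) =
      prob (X -` a \<inter> space M) * prob (Y -` b \<inter> space M)"
    if "a \<in> sets S" "b \<in> sets T1" for a b
  proof -
    have "Z -` space T2 \<inter> space M = space M"
      using measurable_space[OF \<open>random_variable T2 Z\<close>] by auto
    moreover have "(X -` a \<inter> space M) \<inter> (Y -` b \<inter> space M) \<inter> space M =
        (X -` a \<inter> space M) \<inter> (Y -` b \<inter> space M)"
      by auto
    ultimately show ?thesis
      using three[OF that sets.top[of T2]] by (simp add: prob_space rect)
  qed
  have "indep_set R Q"
    unfolding indep_sets2_eq
  proof (intro conjI ballI)
    show "R \<subseteq> events" "Q \<subseteq> events"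
      unfolding R_def Q_def by (auto intro!: measurable_sets[OF rv])
    fix r q assume "r \<in> R" "q \<in> Q"
    then obtain a b c where "a \<in> sets S" "b \<in> sets T1" "c \<in> sets T2"
      "r = ?XY -` (a \<times> b) \<inter> space M" "q = Z -` c \<inter> space M"
      unfolding R_def Q_def by blast
    then show "prob (r \<inter> q) = prob r * prob q"
      by (simp only: rect three two[unfolded rect])
  qed
  moreover have "Int_stable R"
    unfolding Int_stable_def
  proof (intro ballI)
    fix r1 r2 assume "r1 \<in> R" "r2 \<in> R"
    then obtain a1 b1 a2 b2 where *: "a1 \<in> sets S" "b1 \<in> sets T1" "a2 \<in> sets S" "b2 \<in> sets T1"
      "r1 = ?XY -` (a1 \<times> b1) \<inter> space M" "r2 = ?XY -` (a2 \<times> b2) \<inter> space M"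
      unfolding R_def by blast
    then have "r1 \<inter> r2 = ?XY -` ((a1 \<inter> a2) \<times> (b1 \<inter> b2)) \<inter> space M"
      by auto
    moreover have "a1 \<inter> a2 \<in> sets S" "b1 \<inter> b2 \<in> sets T1"
      using * by auto
    ultimately show "r1 \<inter> r2 \<in> R"
      unfolding R_def by blast
  qed
  moreover have "Int_stable Q"
    unfolding Q_def by (rule Int_stable_vimage)
  ultimately have indep: "indep_set (sigma_sets (space M) R) (sigma_sets (space M) Q)"
    by (rule indep_set_sigma_sets)
  have "?XY \<in> space M \<rightarrow> space S \<times> space T1"
    using measurable_space[OF rv] by (auto simp: space_pair_measure)
  then have "{?XY -` A \<inter> space M |A. A \<in> sets (S \<Otimes>\<^sub>M T1)} = sigma_sets (space M) R"
    unfolding sets_pair_measure R_def by (rule sigma_sets_vimage_commute)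
  then have "?XY -` A \<inter> space M \<in> sigma_sets (space M) R"
    using A by blast
  moreover have "Z -` c \<inter> space M \<in> sigma_sets (space M) Q"
    unfolding Q_def using c by (intro sigma_sets.Basic) auto
  ultimately show ?thesis
    using indep unfolding indep_sets2_eq by blast
qed

text \<open>\<open>indep_var\<close> requires both variables to share a value type. Independence of
  \<open>U\<close> and \<open>Z\<close> is therefore kept as a product rule on events until
  \<open>F\<close> and \<open>h\<close> map them to a common type.\<close>

lemma indep_var_compose_of_prob:
  assumes U: "random_variable S U" and Z: "random_variable R Z"
    and prod: "\<And>A c. A \<in> sets S \<Longrightarrow> c \<in> sets R \<Longrightarrow>
      prob ((U -` A \<inter> space M) \<inter> (Z -` c \<inter> space M)) =
      prob (U -` A \<inter> space M) * prob (Z -` c \<inter> space M)"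
    and F: "F \<in> measurable S N1" and h: "h \<in> measurable R N2"
  shows "indep_var N1 (\<lambda>\<omega>. F (U \<omega>)) N2 (\<lambda>\<omega>. h (Z \<omega>))"
  unfolding indep_var_eq
proof (intro conjI indep_set_sigma_sets Int_stable_vimage)
  show rv: "random_variable N1 (\<lambda>\<omega>. F (U \<omega>))" "random_variable N2 (\<lambda>\<omega>. h (Z \<omega>))"
    using measurable_compose[OF U F] measurable_compose[OF Z h] by auto
  show "indep_set {(\<lambda>\<omega>. F (U \<omega>)) -` A \<inter> space M |A. A \<in> sets N1}
      {(\<lambda>\<omega>. h (Z \<omega>)) -` A \<inter> space M |A. A \<in> sets N2}"
    unfolding indep_sets2_eq
  proof (intro conjI ballI)
    show "{(\<lambda>\<omega>. F (U \<omega>)) -` A \<inter> space M |A. A \<in> sets N1} \<subseteq> events"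
      "{(\<lambda>\<omega>. h (Z \<omega>)) -` A \<inter> space M |A. A \<in> sets N2} \<subseteq> events"
      using rv by (auto intro!: measurable_sets)
    fix a b assume "a \<in> {(\<lambda>\<omega>. F (U \<omega>)) -` A \<inter> space M |A. A \<in> sets N1}"
      "b \<in> {(\<lambda>\<omega>. h (Z \<omega>)) -` A \<inter> space M |A. A \<in> sets N2}"
    then obtain A B where A: "A \<in> sets N1" "a = (\<lambda>\<omega>. F (U \<omega>)) -` A \<inter> space M"
      and B: "B \<in> sets N2" "b = (\<lambda>\<omega>. h (Z \<omega>)) -` B \<inter> space M"
      by blast
    have "a = U -` (F -` A \<inter> space S) \<inter> space M" "b = Z -` (h -` B \<inter> space R) \<inter> space M"
      using measurable_space[OF U] measurable_space[OF Z] A B by auto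
    then show "prob (a \<inter> b) = prob a * prob b"
      using prod[OF measurable_sets[OF F A(1)] measurable_sets[OF h B(1)]] by simp
  qed
qed

end

text \<open>The index set \<open>{..<n}\<close> records causality: up to time \<open>n\<close> the
  control is a function of the input path and the first \<open>n\<close> delays.\<close>

lemma measurable_loop_resp:
  assumes "k \<le> n"
  shows "(\<lambda>x. loop_resp g C (fst x) (snd x) k) \<in>
    borel_measurable (PiM UNIV (\<lambda>_. borel) \<Otimes>\<^sub>M PiM {..<n} (\<lambda>_. count_space UNIV))"
  using assms
proof (induction k rule: less_induct)
  case (less k)
  have [measurable]: "(\<lambda>x. fst x j) \<in>
      borel_measurable (PiM UNIV (\<lambda>_. borel) \<Otimes>\<^sub>M PiM {..<n} (\<lambda>_. count_space UNIV))" for j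
    by (rule measurable_compose[OF measurable_fst measurable_component_singleton]) simp
  have C: "(\<lambda>x. C (snd x m) j) \<in>
      borel_measurable (PiM UNIV (\<lambda>_. borel) \<Otimes>\<^sub>M PiM {..<n} (\<lambda>_. count_space UNIV))"
    if "m < n" for m j
    using that
    by (intro measurable_compose[OF measurable_compose[OF measurable_snd
          measurable_component_singleton], where g = "\<lambda>t. C t j"]) auto
  show ?case
    unfolding loop_resp.simps[of _ _ _ _ k]
    using less by (intro borel_measurable_diff borel_measurable_sum borel_measurable_times C) auto
qed

section \<open>The closed loop as a random process\<close>

text \<open>The sequences \<open>g\<close> and \<open>C\<close> are kept abstract apart from the
  mean-zero property, and the probability space is arbitrary, so that the moment formula serves both
  the given input and the test input.\<close>

locale delay_feedback = prob_space M for M :: "'a measure" +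
  fixes T :: nat and p :: "nat \<Rightarrow> real" and tau :: "nat \<Rightarrow> 'a \<Rightarrow> nat" and v :: "nat \<Rightarrow> 'a \<Rightarrow> real"
    and g :: "nat \<Rightarrow> real" and C :: "nat \<Rightarrow> nat \<Rightarrow> real"
  assumes delays: "delay_iid M T p tau"
    and noise: "white_noise M v"
    and indep: "indep_of_delays M v tau"
    and C_mean: "\<And>m. (\<Sum>t\<le>T. p t * C t m) = 0"
begin

abbreviation "input_space \<equiv> PiM UNIV (\<lambda>_::nat. borel :: real measure)"
abbreviation "delay_space J \<equiv> PiM J (\<lambda>_::nat. count_space (UNIV :: nat set))"

text \<open>The whole input path, future included, with the delays before time \<open>n\<close>: all
  of this is independent of \<open>tau n\<close>.\<close>

definition past :: "nat \<Rightarrow> 'a \<Rightarrow> (nat \<Rightarrow> real) \<times> (nat \<Rightarrow> nat)" where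
  "past n \<omega> = (\<lambda>k. v k \<omega>, restrict (\<lambda>m. tau m \<omega>) {..<n})"

definition control :: "nat \<Rightarrow> 'a \<Rightarrow> real" where
  "control k \<omega> = loop_resp g C (\<lambda>k. v k \<omega>) (\<lambda>n. tau n \<omega>) k"

lemma measurable_tau [measurable]: "tau n \<in> measurable M (count_space UNIV)"
  using delays unfolding delay_iid_def indep_vars_def by simp

lemma measurable_v [measurable]: "v k \<in> borel_measurable M"
  using noise by (simp add: white_noise_def)

lemma measurable_tau_restrict:
  "(\<lambda>\<omega>. restrict (\<lambda>m. tau m \<omega>) J) \<in> measurable M (delay_space J)"
  by (intro measurable_restrict) simp

lemma measurable_v_path: "(\<lambda>\<omega> k. v k \<omega>) \<in> measurable M input_space"
  by (rule measurable_PiM_single') auto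

lemma measurable_past: "past n \<in> measurable M (input_space \<Otimes>\<^sub>M delay_space {..<n})"
  unfolding past_def by (intro measurable_Pair measurable_v_path measurable_tau_restrict)

text \<open>The input is first separated from all delays jointly; then \<open>tau n\<close> is
  separated from the earlier delays by their mutual independence.\<close>

lemma prob_input_delays:
  assumes a: "a \<in> sets input_space" and b: "b \<in> sets (delay_space {..<n})"
  shows "prob (((\<lambda>\<omega> k. v k \<omega>) -` a \<inter> space M)
      \<inter> ((\<lambda>\<omega>. restrict (\<lambda>m. tau m \<omega>) {..<n}) -` b \<inter> space M)
      \<inter> (tau n -` c \<inter> space M)) =
    prob ((\<lambda>\<omega> k. v k \<omega>) -` a \<inter> space M)
      * prob ((\<lambda>\<omega>. restrict (\<lambda>m. tau m \<omega>) {..<n}) -` b \<inter> space M)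
      * prob (tau n -` c \<inter> space M)"
proof -
  let ?Y = "\<lambda>\<omega>. restrict (\<lambda>m. tau m \<omega>) {..<n}"
  \<comment> \<open>The two variables of \<^const>\<open>prob_space.indep_var\<close> must have the same type, so in
    \<^const>\<open>indep_of_delays\<close> the delays appear coerced to reals; \<open>?dec\<close> undoes the coercion.\<close>
  let ?P = "PiM UNIV (\<lambda>_::nat. count_space (UNIV :: real set))"
  let ?dec = "\<lambda>x :: nat \<Rightarrow> real. (restrict (\<lambda>m. nat \<lfloor>x m\<rfloor>) {..<n}, nat \<lfloor>x n\<rfloor>)"
  have "(\<lambda>x. nat \<lfloor>x m\<rfloor>) \<in> measurable ?P (count_space UNIV)" for m :: nat
    by (rule measurable_compose[OF measurable_component_singleton[of m]]) auto
  then have dec: "?dec \<in> measurable ?P (delay_space {..<n} \<Otimes>\<^sub>M count_space UNIV)"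
    by (intro measurable_Pair measurable_restrict)
  have bc: "b \<times> c \<in> sets (delay_space {..<n} \<Otimes>\<^sub>M count_space UNIV)"
    using b by auto
  let ?B = "?dec -` (b \<times> c) \<inter> space ?P"
  have path: "(\<lambda>m. real (tau m \<omega>)) \<in> space ?P" for \<omega>
    by (simp add: space_PiM)
  have enc: "(\<lambda>\<omega> m. real (tau m \<omega>)) -` ?B \<inter> space M = (?Y -` b \<inter> space M) \<inter> (tau n -` c \<inter> space M)"
    using path by auto
  have "((\<lambda>\<omega> k. v k \<omega>) -` a \<inter> space M) \<inter> (?Y -` b \<inter> space M) \<inter> (tau n -` c \<inter> space M) =
      (\<lambda>\<omega>. (\<lambda>k. v k \<omega>, \<lambda>m. real (tau m \<omega>))) -` (a \<times> ?B) \<inter> space M"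
    using enc by blast
  also have "prob \<dots> = prob ((\<lambda>\<omega> k. v k \<omega>) -` a \<inter> space M)
      * prob ((\<lambda>\<omega> m. real (tau m \<omega>)) -` ?B \<inter> space M)"
    by (rule indep_varD[OF indep[unfolded indep_of_delays_def] a measurable_sets[OF dec bc]])
  also have "prob ((\<lambda>\<omega> m. real (tau m \<omega>)) -` ?B \<inter> space M) =
      prob (?Y -` b \<inter> space M) * prob (tau n -` c \<inter> space M)"
  proof -
    let ?Z = "\<lambda>\<omega>. restrict (\<lambda>m. tau m \<omega>) {n}"
    let ?c = "(\<lambda>x. x n) -` c \<inter> space (delay_space {n})"
    have "indep_vars (\<lambda>_. count_space UNIV) tau UNIV"
      using delays by (simp add: delay_iid_def)
    then have "indep_var (delay_space {..<n}) ?Y (delay_space {n}) ?Z"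
      by (rule indep_var_restrict) auto
    moreover have "?c \<in> sets (delay_space {n})"
      by (rule measurable_sets[OF measurable_component_singleton]) auto
    ultimately have "prob ((\<lambda>\<omega>. (?Y \<omega>, ?Z \<omega>)) -` (b \<times> ?c) \<inter> space M) =
        prob (?Y -` b \<inter> space M) * prob (?Z -` ?c \<inter> space M)"
      using b by (intro indep_varD)
    moreover have "?Z -` ?c \<inter> space M = tau n -` c \<inter> space M"
      by (auto simp: space_PiM)
    moreover have "(\<lambda>\<omega>. (?Y \<omega>, ?Z \<omega>)) -` (b \<times> ?c) \<inter> space M =
        (?Y -` b \<inter> space M) \<inter> (?Z -` ?c \<inter> space M)"
      by auto
    ultimately show ?thesis
      unfolding enc by simp
  qed
  finally show ?thesis
    by (simp only: mult.assoc)
qed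

lemma past_indep:
  assumes "A \<in> sets (input_space \<Otimes>\<^sub>M delay_space {..<n})"
  shows "prob ((past n -` A \<inter> space M) \<inter> (tau n -` c \<inter> space M)) =
    prob (past n -` A \<inter> space M) * prob (tau n -` c \<inter> space M)"
  unfolding past_def[abs_def]
  by (rule prob_pair_inter_eq_times[OF measurable_v_path measurable_tau_restrict measurable_tau
        prob_input_delays assms]) simp_all

text \<open>Almost surely the delay is at most \<open>T\<close>, so
  \<open>h (tau n \<omega>)\<close> agrees almost everywhere with a finite combination of
  indicators.\<close>

lemma tau_function:
  fixes h :: "nat \<Rightarrow> real"
  shows "integrable M (\<lambda>\<omega>. h (tau n \<omega>))"
    and "expectation (\<lambda>\<omega>. h (tau n \<omega>)) = (\<Sum>t\<le>T. p t * h t)"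
proof -
  let ?s = "\<lambda>\<omega>. \<Sum>t\<le>T. h t * indicator {\<omega> \<in> space M. tau n \<omega> = t} \<omega>"
  have [measurable]: "(\<lambda>\<omega>. h (tau n \<omega>)) \<in> borel_measurable M"
    by (rule measurable_compose[OF measurable_tau]) simp
  have ev: "{\<omega> \<in> space M. tau n \<omega> = t} \<in> events" for t
    by measurable
  have ind: "integrable M (indicat_real {\<omega> \<in> space M. tau n \<omega> = t})" for t
    using ev by (intro integrable_real_indicator) (auto simp: emeasure_eq_measure)
  have "AE \<omega> in M. tau n \<omega> \<le> T"
    using delays by (simp add: delay_iid_def)
  moreover have "h (tau n \<omega>) = ?s \<omega>" if "tau n \<omega> \<le> T" "\<omega> \<in> space M" for \<omega>
  proof -
    have "?s \<omega> = (\<Sum>t\<le>T. if t = tau n \<omega> then h (tau n \<omega>) else 0)"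
      using that by (intro sum.cong) (auto simp: indicator_def)
    then show ?thesis
      using that by simp
  qed
  ultimately have ae: "AE \<omega> in M. h (tau n \<omega>) = ?s \<omega>"
    by (auto elim!: AE_mp)
  have s: "integrable M ?s"
    using ind by (intro Bochner_Integration.integrable_sum integrable_mult_right)
  show "integrable M (\<lambda>\<omega>. h (tau n \<omega>))"
    using s by (subst integrable_cong_AE[OF _ _ ae]) auto
  have "expectation (\<lambda>\<omega>. h (tau n \<omega>)) = expectation ?s"
    using s by (intro integral_cong_AE ae) auto
  also have "\<dots> = (\<Sum>t\<le>T. h t * prob {\<omega> \<in> space M. tau n \<omega> = t})"
    using ev ind by (subst Bochner_Integration.integral_sum) auto
  also have "\<dots> = (\<Sum>t\<le>T. p t * h t)"
    using delays by (intro sum.cong) (auto simp: delay_iid_def)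
  finally show "expectation (\<lambda>\<omega>. h (tau n \<omega>)) = (\<Sum>t\<le>T. p t * h t)" .
qed

lemma expectation_past_times_tau:
  fixes h :: "nat \<Rightarrow> real"
  assumes F: "F \<in> borel_measurable (input_space \<Otimes>\<^sub>M delay_space {..<n})"
    and int: "integrable M (\<lambda>\<omega>. F (past n \<omega>))"
  shows "integrable M (\<lambda>\<omega>. F (past n \<omega>) * h (tau n \<omega>))"
    and "expectation (\<lambda>\<omega>. F (past n \<omega>) * h (tau n \<omega>)) =
      expectation (\<lambda>\<omega>. F (past n \<omega>)) * (\<Sum>t\<le>T. p t * h t)"
proof -
  have *: "indep_var borel (\<lambda>\<omega>. F (past n \<omega>)) borel (\<lambda>\<omega>. h (tau n \<omega>))"
    by (rule indep_var_compose_of_prob[OF measurable_past measurable_tau past_indep F]) simp_all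
  show "integrable M (\<lambda>\<omega>. F (past n \<omega>) * h (tau n \<omega>))"
    by (rule indep_var_integrable[OF * int tau_function(1)])
  show "expectation (\<lambda>\<omega>. F (past n \<omega>) * h (tau n \<omega>)) =
      expectation (\<lambda>\<omega>. F (past n \<omega>)) * (\<Sum>t\<le>T. p t * h t)"
    using indep_var_lebesgue_integral[OF * int tau_function(1)] by (simp add: tau_function(2))
qed

lemma control_past: "k \<le> n \<Longrightarrow> control k \<omega> = loop_resp g C (fst (past n \<omega>)) (snd (past n \<omega>)) k"
  unfolding control_def past_def by (auto intro!: loop_resp_cong)

lemma tau_past: "m < n \<Longrightarrow> tau m \<omega> = snd (past n \<omega>) m"
  by (simp add: past_def)

lemma v_past: "v j \<omega> = fst (past n \<omega>) j"
  by (simp add: past_def)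

lemma control_rec:
  "control k \<omega> = (\<Sum>j\<le>k. g j * v (k - j) \<omega>) - (\<Sum>n<k. control n \<omega> * C (tau n \<omega>) (k - n))"
  unfolding control_def by (subst loop_resp.simps) simp

lemma measurable_control: "control k \<in> borel_measurable M"
proof -
  have "control k = (\<lambda>\<omega>. loop_resp g C (fst (past k \<omega>)) (snd (past k \<omega>)) k)"
    by (intro ext control_past) simp
  then show ?thesis
    using measurable_compose[OF measurable_past measurable_loop_resp[of k k]] by simp
qed

lemma square_integrable_v: "square_integrable (v k)"
  using noise by (simp add: white_noise_def square_integrable_def)

lemma control_times_gain:
  fixes h :: "nat \<Rightarrow> real"
  assumes "square_integrable (control n)"
  shows "square_integrable (\<lambda>\<omega>. control n \<omega> * h (tau n \<omega>))"
    and "expectation (\<lambda>\<omega>. (control n \<omega> * h (tau n \<omega>))\<^sup>2) =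
      expectation (\<lambda>\<omega>. (control n \<omega>)\<^sup>2) * (\<Sum>t\<le>T. p t * (h t)\<^sup>2)"
proof -
  let ?F = "\<lambda>x. (loop_resp g C (fst x) (snd x) n)\<^sup>2"
  have F: "?F \<in> borel_measurable (input_space \<Otimes>\<^sub>M delay_space {..<n})"
    by (intro borel_measurable_power measurable_loop_resp) simp
  have int: "integrable M (\<lambda>\<omega>. ?F (past n \<omega>))"
    using assms by (simp add: square_integrable_def flip: control_past)
  have sq: "(\<lambda>\<omega>. (control n \<omega> * h (tau n \<omega>))\<^sup>2) = (\<lambda>\<omega>. ?F (past n \<omega>) * (h (tau n \<omega>))\<^sup>2)"
    by (simp add: power_mult_distrib flip: control_past)
  note * = expectation_past_times_tau[OF F int, of "\<lambda>t. (h t)\<^sup>2"]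
  have "(\<lambda>\<omega>. h (tau n \<omega>)) \<in> borel_measurable M"
    by (rule measurable_compose[OF measurable_tau]) simp
  then show "square_integrable (\<lambda>\<omega>. control n \<omega> * h (tau n \<omega>))"
    using *(1) measurable_control[of n] unfolding square_integrable_def sq by simp
  show "expectation (\<lambda>\<omega>. (control n \<omega> * h (tau n \<omega>))\<^sup>2) =
      expectation (\<lambda>\<omega>. (control n \<omega>)\<^sup>2) * (\<Sum>t\<le>T. p t * (h t)\<^sup>2)"
    using *(2) unfolding sq by (simp flip: control_past)
qed

lemma square_integrable_control: "square_integrable (control k)"
proof (induction k rule: less_induct)
  case (less k)
  have "square_integrable (\<lambda>\<omega>. (\<Sum>j\<le>k. g j * v (k - j) \<omega>)
      - (\<Sum>n<k. control n \<omega> * C (tau n \<omega>) (k - n)))"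
    using less by (intro square_integrable_diff square_integrable_sum square_integrable_cmult
        square_integrable_v control_times_gain(1)) simp
  then show ?case
    unfolding control_rec[symmetric] by simp
qed

theorem control_second_moment:
  "expectation (\<lambda>\<omega>. (control k \<omega>)\<^sup>2) =
    (\<Sum>j\<le>k. (g j)\<^sup>2 * expectation (\<lambda>\<omega>. (v (k - j) \<omega>)\<^sup>2)) +
    (\<Sum>n<k. expectation (\<lambda>\<omega>. (control n \<omega>)\<^sup>2) * (\<Sum>t\<le>T. p t * (C t (k - n))\<^sup>2))"
proof -
  let ?x = "\<lambda>\<omega>. \<Sum>j\<le>k. g j * v (k - j) \<omega>"
  let ?y = "\<lambda>n \<omega>. control n \<omega> * C (tau n \<omega>) (k - n)"
  note y_sq = control_times_gain[OF square_integrable_control, of _ "\<lambda>t. C t m" for m]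
  have x_sq: "square_integrable ?x"
    by (intro square_integrable_sum square_integrable_cmult square_integrable_v)
  have x2: "expectation (\<lambda>\<omega>. (?x \<omega>)\<^sup>2) =
      (\<Sum>j\<le>k. (g j)\<^sup>2 * expectation (\<lambda>\<omega>. (v (k - j) \<omega>)\<^sup>2))"
  proof (subst expectation_orthogonal_sum)
    fix i j assume "i \<in> {..k}" "j \<in> {..k}" "i \<noteq> j"
    then have "expectation (\<lambda>\<omega>. v (k - i) \<omega> * v (k - j) \<omega>) = 0"
      using noise by (auto simp: white_noise_def)
    moreover have "(\<lambda>\<omega>. g i * v (k - i) \<omega> * (g j * v (k - j) \<omega>)) =
        (\<lambda>\<omega>. g i * g j * (v (k - i) \<omega> * v (k - j) \<omega>))"
      by (simp add: ac_simps)
    ultimately show "expectation (\<lambda>\<omega>. g i * v (k - i) \<omega> * (g j * v (k - j) \<omega>)) = 0"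
      by simp
  qed (auto simp: power_mult_distrib intro: square_integrable_cmult square_integrable_v)
  \<comment> \<open>\<open>past n\<close> contains the complete input path, so \<open>?x\<close>
    times \<open>control n\<close> is a function of it; the remaining factor depends on
    \<open>tau n\<close> alone and has mean zero.\<close>
  have xy: "expectation (\<lambda>\<omega>. ?x \<omega> * ?y n \<omega>) = 0" if "n < k" for n
  proof -
    let ?F = "\<lambda>x. (\<Sum>j\<le>k. g j * fst x (k - j)) * loop_resp g C (fst x) (snd x) n"
    have "(\<lambda>x. fst x j) \<in> borel_measurable (input_space \<Otimes>\<^sub>M delay_space {..<n})" for j
      by (rule measurable_compose[OF measurable_fst measurable_component_singleton]) simp
    then have F: "?F \<in> borel_measurable (input_space \<Otimes>\<^sub>M delay_space {..<n})"
      by (intro borel_measurable_times borel_measurable_sum measurable_loop_resp) auto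
    have eq: "?x \<omega> * control n \<omega> = ?F (past n \<omega>)" for \<omega>
      by (simp flip: control_past v_past)
    have "integrable M (\<lambda>\<omega>. ?F (past n \<omega>))"
      unfolding eq[symmetric] by (intro square_integrable_mult x_sq square_integrable_control)
    from expectation_past_times_tau(2)[OF F this, of "\<lambda>t. C t (k - n)"] show ?thesis
      unfolding eq[symmetric] by (simp add: C_mean mult.assoc)
  qed
  \<comment> \<open>Every factor except the gain of the later delay \<open>tau m\<close> is a
    function of \<open>past m\<close>, and that gain has mean zero.\<close>
  have yy: "expectation (\<lambda>\<omega>. ?y n \<omega> * ?y m \<omega>) = 0" if "n < m" "m < k" for n m
  proof -
    let ?F = "\<lambda>x. loop_resp g C (fst x) (snd x) n * C (snd x n) (k - n)
      * loop_resp g C (fst x) (snd x) m"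
    have "(\<lambda>x. C (snd x n) (k - n)) \<in> borel_measurable (input_space \<Otimes>\<^sub>M delay_space {..<m})"
      using that by (intro measurable_compose[OF measurable_compose[OF measurable_snd
          measurable_component_singleton], where g = "\<lambda>t. C t (k - n)"]) auto
    then have F: "?F \<in> borel_measurable (input_space \<Otimes>\<^sub>M delay_space {..<m})"
      using that by (intro borel_measurable_times measurable_loop_resp) auto
    have eq: "?y n \<omega> * control m \<omega> = ?F (past m \<omega>)" for \<omega>
      using that by (simp flip: control_past tau_past)
    have "integrable M (\<lambda>\<omega>. ?F (past m \<omega>))"
      unfolding eq[symmetric] by (intro square_integrable_mult y_sq(1) square_integrable_control)
    from expectation_past_times_tau(2)[OF F this, of "\<lambda>t. C t (k - m)"] show ?thesis
      unfolding eq[symmetric] by (simp add: C_mean mult.assoc)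
  qed
  have y2: "expectation (\<lambda>\<omega>. (\<Sum>n<k. ?y n \<omega>)\<^sup>2) =
      (\<Sum>n<k. expectation (\<lambda>\<omega>. (control n \<omega>)\<^sup>2) * (\<Sum>t\<le>T. p t * (C t (k - n))\<^sup>2))"
  proof (subst expectation_orthogonal_sum)
    fix i j assume "i \<in> {..<k}" "j \<in> {..<k}" "i \<noteq> j"
    then show "expectation (\<lambda>\<omega>. ?y i \<omega> * ?y j \<omega>) = 0"
      using yy[of i j] yy[of j i] by (cases "i < j") (auto simp: mult.commute)
  qed (auto simp: y_sq)
  have "expectation (\<lambda>\<omega>. ?x \<omega> * (\<Sum>n<k. ?y n \<omega>)) = (\<Sum>n<k. expectation (\<lambda>\<omega>. ?x \<omega> * ?y n \<omega>))"
    unfolding sum_distrib_left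
    by (intro Bochner_Integration.integral_sum square_integrable_mult x_sq y_sq(1))
  then have "expectation (\<lambda>\<omega>. ?x \<omega> * (\<Sum>n<k. ?y n \<omega>)) = 0"
    using xy by simp
  then have "expectation (\<lambda>\<omega>. (?x \<omega> - (\<Sum>n<k. ?y n \<omega>))\<^sup>2) =
      expectation (\<lambda>\<omega>. (?x \<omega>)\<^sup>2) + expectation (\<lambda>\<omega>. (\<Sum>n<k. ?y n \<omega>)\<^sup>2)"
    by (intro expectation_orthogonal_diff x_sq square_integrable_sum y_sq(1))
  then show ?thesis
    unfolding control_rec[symmetric] x2 y2 .
qed

end

subsection \<open>A test input of random signs\<close>

lemma (in prob_space) white_noise_of_indep:
  assumes v: "indep_vars (\<lambda>_. borel) v UNIV"
    and sq: "\<And>k. integrable M (\<lambda>\<omega>. (v k \<omega>)\<^sup>2)"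
    and mean: "\<And>k. expectation (v k) = 0"
    and bdd: "\<exists>B. \<forall>k. expectation (\<lambda>\<omega>. (v k \<omega>)\<^sup>2) \<le> B"
  shows "white_noise M v"
  unfolding white_noise_def
proof (intro conjI allI impI sq mean bdd)
  show meas: "v k \<in> borel_measurable M" for k
    using v unfolding indep_vars_def by simp
  fix k j :: nat assume kj: "k \<noteq> j"
  have int: "integrable M (v i)" for i
    using meas sq by (rule square_integrable_imp_integrable)
  have "expectation (\<lambda>\<omega>. \<Prod>i\<in>{k, j}. v i \<omega>) = (\<Prod>i\<in>{k, j}. expectation (v i))"
    using indep_vars_subset[OF v, of "{k, j}"] int by (intro indep_vars_lebesgue_integral) auto
  then show "expectation (\<lambda>\<omega>. v k \<omega> * v j \<omega>) = 0"
    using kj by (simp add: mean)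
qed

text \<open>A fair random sign, with mean 0 and variance 1. It is pushed to \<open>borel\<close>
  because a pmf carries the discrete sigma-algebra.\<close>

definition sign_law :: "real measure" where
  "sign_law = distr (measure_pmf (pmf_of_set {-1, 1})) borel (\<lambda>x. x)"

lemma prob_space_sign_law: "prob_space sign_law"
  unfolding sign_law_def by (intro measure_pmf.prob_space_distr) simp

lemma sign_law_moments:
  "integrable sign_law (\<lambda>x. x\<^sup>2)" "(\<integral>x. x \<partial>sign_law) = 0" "(\<integral>x. x\<^sup>2 \<partial>sign_law) = 1"
  unfolding sign_law_def
  by (simp_all add: integrable_distr_eq integral_distr integrable_measure_pmf_finite
      integral_pmf_of_set)

text \<open>Stability quantifies over laws on the canonical space. The product of independent signs
  with the law of the given delay path is such a law, independent of the delays by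
  construction.\<close>

definition test_law :: "'a measure \<Rightarrow> (nat \<Rightarrow> 'a \<Rightarrow> nat) \<Rightarrow> canon measure" where
  "test_law M tau = PiM UNIV (\<lambda>_. sign_law) \<Otimes>\<^sub>M
     distr M (PiM UNIV (\<lambda>_. count_space UNIV)) (\<lambda>\<omega> n. tau n \<omega>)"

context prob_space
begin

context
  fixes T :: nat and p :: "nat \<Rightarrow> real" and tau :: "nat \<Rightarrow> 'a \<Rightarrow> nat"
  assumes delays: "delay_iid M T p tau"
begin

private abbreviation "V \<equiv> PiM UNIV (\<lambda>_::nat. sign_law)"
private abbreviation "W \<equiv> distr M (PiM UNIV (\<lambda>_. count_space UNIV)) (\<lambda>\<omega> n. tau n \<omega>)"
private abbreviation "\<Omega> \<equiv> test_law M tau"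

private lemma tau_meas: "tau n \<in> measurable M (count_space UNIV)"
  using delays unfolding delay_iid_def indep_vars_def by simp

private lemma tau_path: "(\<lambda>\<omega> n. tau n \<omega>) \<in> measurable M (PiM UNIV (\<lambda>_. count_space UNIV))"
  by (rule measurable_PiM_single') (auto simp: tau_meas)

private lemma prob_W: "prob_space W"
  using tau_path by (rule prob_space_distr)

private lemma prob_V: "prob_space V"
  by (rule prob_space_PiM[OF prob_space_sign_law])

private lemma sets_V: "sets V = sets (PiM UNIV (\<lambda>_. borel))"
  by (intro sets_PiM_cong) (simp_all add: sign_law_def)

lemma prob_space_test_law: "prob_space \<Omega>"
proof -
  interpret V: prob_space V by (rule prob_V)
  interpret W: prob_space W by (rule prob_W)
  interpret pair_prob_space V W ..
  show ?thesis
    unfolding test_law_def by (rule P.prob_space_axioms)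
qed

lemma sets_test_law: "sets \<Omega> = sets canon_space"
  unfolding test_law_def canon_space_def by (intro sets_pair_measure_cong sets_V) simp

private lemma distr_fst: "distr \<Omega> V fst = V"
  unfolding test_law_def by (rule prob_space.distr_pair_fst[OF prob_W])

private lemma distr_snd: "distr \<Omega> W snd = W"
proof -
  interpret V: prob_space V by (rule prob_V)
  interpret W: prob_space W by (rule prob_W)
  interpret pair_sigma_finite V W ..
  have "distr \<Omega> W snd = distr (distr (W \<Otimes>\<^sub>M V) (V \<Otimes>\<^sub>M W) (\<lambda>(x, y). (y, x))) W snd"
    unfolding test_law_def by (subst distr_pair_swap) simp
  also have "\<dots> = distr (W \<Otimes>\<^sub>M V) W fst"
    by (subst distr_distr) (auto simp: comp_def split_beta)
  also have "\<dots> = W"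
    by (rule V.distr_pair_fst)
  finally show ?thesis .
qed

private lemma measurable_fst': "fst \<in> measurable \<Omega> V"
  unfolding test_law_def by (rule measurable_fst)

private lemma measurable_snd': "snd \<in> measurable \<Omega> W"
  unfolding test_law_def by (rule measurable_snd)

private lemma distr_coord_V: "distr \<Omega> borel (\<lambda>x. fst x k) = sign_law"
proof -
  interpret V: product_prob_space "\<lambda>_. sign_law" "UNIV :: nat set"
    by (simp add: product_prob_space_def product_prob_space_axioms_def prob_space_sign_law
        product_sigma_finite_def prob_space_imp_sigma_finite)
  have comp: "(\<lambda>x. x k) \<in> measurable V borel"
    using measurable_component_singleton[of k UNIV "\<lambda>_. sign_law"]
    by (simp add: sign_law_def cong: measurable_cong_sets)
  have "distr \<Omega> borel (\<lambda>x. fst x k) = distr (distr \<Omega> V fst) borel (\<lambda>x. x k)"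
    by (subst distr_distr[OF comp measurable_fst']) (simp add: comp_def)
  also have "\<dots> = distr V borel (\<lambda>x. x k)"
    by (simp only: distr_fst)
  also have "\<dots> = distr V sign_law (\<lambda>x. x k)"
    by (rule distr_cong) (simp_all add: sign_law_def)
  also have "\<dots> = sign_law"
    by (rule V.PiM_component) simp
  finally show ?thesis .
qed

private lemma coord_W:
  "(\<lambda>x. snd x n) \<in> measurable \<Omega> (count_space UNIV)"
  "distr \<Omega> (count_space UNIV) (\<lambda>x. snd x n) = distr M (count_space UNIV) (tau n)"
proof -
  have comp: "(\<lambda>x. x n) \<in> measurable W (count_space UNIV)"
    using measurable_component_singleton[of n UNIV "\<lambda>_. count_space UNIV"] by simp
  show "(\<lambda>x. snd x n) \<in> measurable \<Omega> (count_space UNIV)"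
    using measurable_compose[OF measurable_snd' comp] .
  have "distr \<Omega> (count_space UNIV) (\<lambda>x. snd x n) =
      distr (distr \<Omega> W snd) (count_space UNIV) (\<lambda>x. x n)"
    by (subst distr_distr[OF comp measurable_snd']) (simp add: comp_def)
  also have "\<dots> = distr M (count_space UNIV) (tau n)"
    unfolding distr_snd using comp by (subst distr_distr[OF _ tau_path]) (simp_all add: comp_def)
  finally show "distr \<Omega> (count_space UNIV) (\<lambda>x. snd x n) = distr M (count_space UNIV) (tau n)" .
qed

lemma test_law_noise:
  "white_noise \<Omega> (\<lambda>k x. fst x k)"
  "prob_space.expectation \<Omega> (\<lambda>x. (fst x k)\<^sup>2) = 1"
proof -
  interpret N: prob_space \<Omega> by (rule prob_space_test_law)
  have rv: "(\<lambda>x. fst x k) \<in> borel_measurable \<Omega>" for k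
    using measurable_compose[OF measurable_fst' measurable_component_singleton[of k]]
    by (simp add: sign_law_def cong: measurable_cong_sets)
  have sq: "integrable \<Omega> (\<lambda>x. (fst x k)\<^sup>2)" for k
    using sign_law_moments(1) rv[of k]
    by (simp add: integrable_distr_eq flip: distr_coord_V[of k])
  have mean: "N.expectation (\<lambda>x. fst x k) = 0" for k
    using sign_law_moments(2) rv[of k] by (simp add: integral_distr flip: distr_coord_V[of k])
  have var: "N.expectation (\<lambda>x. (fst x k)\<^sup>2) = 1" for k
    using sign_law_moments(3) rv[of k] by (simp add: integral_distr flip: distr_coord_V[of k])
  show "N.expectation (\<lambda>x. (fst x k)\<^sup>2) = 1"
    by (rule var)
  have "N.indep_vars (\<lambda>_. borel) (\<lambda>k x. fst x k) UNIV"
  proof (subst N.indep_vars_iff_distr_eq_PiM)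
    have "distr \<Omega> (PiM UNIV (\<lambda>_. borel)) (\<lambda>x. \<lambda>i\<in>UNIV. fst x i) = distr \<Omega> V fst"
      using sets_V by (intro distr_cong) auto
    then show "distr \<Omega> (PiM UNIV (\<lambda>_. borel)) (\<lambda>x. \<lambda>i\<in>UNIV. fst x i) =
        PiM UNIV (\<lambda>i. distr \<Omega> borel (\<lambda>x. fst x i))"
      by (simp only: distr_fst distr_coord_V)
  qed (use rv in auto)
  then show "white_noise \<Omega> (\<lambda>k x. fst x k)"
    using sq mean var by (intro N.white_noise_of_indep) auto
qed

text \<open>Independence is a property of the joint law: the delay path has the same joint and
  marginal laws here as \<open>tau\<close> has under \<open>M\<close>.\<close>

lemma test_law_delays: "delay_iid \<Omega> T p (\<lambda>n x. snd x n)"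
proof -
  interpret N: prob_space \<Omega> by (rule prob_space_test_law)
  have "N.indep_vars (\<lambda>_. count_space UNIV) (\<lambda>n x. snd x n) UNIV"
  proof (subst N.indep_vars_iff_distr_eq_PiM)
    have tau: "indep_vars (\<lambda>_. count_space UNIV) tau UNIV"
      using delays by (simp add: delay_iid_def)
    have "distr \<Omega> (PiM UNIV (\<lambda>_. count_space UNIV)) (\<lambda>x. \<lambda>i\<in>UNIV. snd x i) = distr \<Omega> W snd"
      by (intro distr_cong) auto
    also have "\<dots> = distr M (PiM UNIV (\<lambda>_. count_space UNIV)) (\<lambda>\<omega>. \<lambda>i\<in>UNIV. tau i \<omega>)"
      unfolding distr_snd by (intro distr_cong) auto
    also have "\<dots> = PiM UNIV (\<lambda>i. distr M (count_space UNIV) (tau i))"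
      using tau tau_meas by (subst indep_vars_iff_distr_eq_PiM[symmetric]) auto
    finally show "distr \<Omega> (PiM UNIV (\<lambda>_. count_space UNIV)) (\<lambda>x. \<lambda>i\<in>UNIV. snd x i) =
        PiM UNIV (\<lambda>i. distr \<Omega> (count_space UNIV) (\<lambda>x. snd x i))"
      by (simp only: coord_W(2))
  qed (use coord_W(1) in auto)
  moreover have "measure \<Omega> {x \<in> space \<Omega>. snd x n = i} = p i" if "i \<le> T" for n i
  proof -
    have "measure \<Omega> {x \<in> space \<Omega>. snd x n = i} =
        measure (distr \<Omega> (count_space UNIV) (\<lambda>x. snd x n)) {i}"
      using coord_W(1)[of n] by (subst measure_distr) (auto intro!: arg_cong[where f = "measure \<Omega>"])
    also have "\<dots> = measure M {\<omega> \<in> space M. tau n \<omega> = i}"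
      unfolding coord_W(2) using tau_meas[of n]
      by (subst measure_distr) (auto intro!: arg_cong[where f = prob])
    finally show ?thesis
      using delays that by (simp add: delay_iid_def)
  qed
  moreover have "AE x in \<Omega>. snd x n \<le> T" for n
  proof -
    have "AE \<omega> in M. tau n \<omega> \<le> T"
      using delays by (simp add: delay_iid_def)
    then have "AE t in distr M (count_space UNIV) (tau n). t \<le> T"
      using tau_meas[of n] by (subst AE_distr_iff) auto
    then show ?thesis
      unfolding coord_W(2)[symmetric] using coord_W(1)[of n] by (subst (asm) AE_distr_iff) auto
  qed
  ultimately show ?thesis
    unfolding delay_iid_def by blast
qed

lemma test_law_indep: "indep_of_delays \<Omega> (\<lambda>k x. fst x k) (\<lambda>n x. snd x n)"
proof -
  interpret N: prob_space \<Omega> by (rule prob_space_test_law)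
  interpret V: prob_space V by (rule prob_V)
  interpret W: prob_space W by (rule prob_W)
  have prod: "N.prob ((fst -` A \<inter> space \<Omega>) \<inter> (snd -` c \<inter> space \<Omega>)) =
      N.prob (fst -` A \<inter> space \<Omega>) * N.prob (snd -` c \<inter> space \<Omega>)"
    if A: "A \<in> sets V" and c: "c \<in> sets W" for A c
  proof -
    have "fst -` A \<inter> space \<Omega> = A \<times> space W" "snd -` c \<inter> space \<Omega> = space V \<times> c"
      "(fst -` A \<inter> space \<Omega>) \<inter> (snd -` c \<inter> space \<Omega>) = A \<times> c"
      using sets.sets_into_space[OF A] sets.sets_into_space[OF c]
      unfolding test_law_def space_pair_measure by auto
    moreover have "measure (V \<Otimes>\<^sub>M W) (a \<times> b) = measure V a * measure W b"
      if "a \<in> sets V" "b \<in> sets W" for a b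
      using that by (simp add: measure_def W.emeasure_pair_measure_Times enn2real_mult)
    ultimately show ?thesis
      using A c V.prob_space W.prob_space unfolding test_law_def by simp
  qed
  have F: "(\<lambda>a k. a k) \<in> measurable V (PiM UNIV (\<lambda>_. borel))"
    using sets_V by (simp cong: measurable_cong_sets)
  \<comment> \<open>This map is the coercion to reals that \<open>indep_of_delays\<close>
    inserts.\<close>
  have h: "(\<lambda>t n. real (t n)) \<in> measurable W (PiM UNIV (\<lambda>_. count_space UNIV))"
  proof (rule measurable_PiM_single')
    fix n
    have "(\<lambda>t. t n) \<in> measurable W (count_space UNIV)"
      using measurable_component_singleton[of n UNIV "\<lambda>_. count_space UNIV"] by simp
    then show "(\<lambda>t. real (t n)) \<in> measurable W (count_space UNIV)"
      by (rule measurable_compose) simp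
  qed auto
  show ?thesis
    unfolding indep_of_delays_def
    using N.indep_var_compose_of_prob[OF measurable_fst' measurable_snd' prod F h] by simp
qed

end

end

subsection \<open>The stationary variance\<close>

theorem theorem3:
  fixes Pn Pd Kn Kd \<Phi> :: "real poly"
    and tmax :: nat and \<alpha> p :: "nat \<Rightarrow> real"
    and M :: "'a measure" and tau :: "nat \<Rightarrow> 'a \<Rightarrow> nat"
    and v y u ud :: "nat \<Rightarrow> 'a \<Rightarrow> real" and \<sigma>v2 :: real
  assumes "prob_space M"
    and plant_strictly_proper: "coeff Pd 0 \<noteq> 0" "coeff Pn 0 = 0"
    and controller_proper: "coeff Kd 0 \<noteq> 0"
    and "\<forall>i. 0 \<le> p i" and "(\<Sum>i\<le>tmax. p i) = 1"
    and delays: "delay_iid M tmax p tau"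
    and ms: "ms_stable Pn Pd Kn Kd tmax \<alpha> p"
    and v_indep: "prob_space.indep_vars M (\<lambda>_. borel) v UNIV"
    and v_sq: "\<forall>k. integrable M (\<lambda>\<omega>. (v k \<omega>)\<^sup>2)"
    and v_mean: "\<forall>k. prob_space.expectation M (v k) = 0"
    and v_bdd: "\<exists>B. \<forall>k. prob_space.expectation M (\<lambda>\<omega>. (v k \<omega>)\<^sup>2) \<le> B"
    and v_tau: "indep_of_delays M v tau"
    and v_lim: "(\<lambda>k. prob_space.expectation M (\<lambda>\<omega>. (v k \<omega>)\<^sup>2)) \<longlonglongrightarrow> \<sigma>v2"
    and loop: "\<forall>\<omega>\<in>space M. loop_eqs Pn Pd Kn Kd tmax \<alpha> (\<lambda>k. v k \<omega>) (\<lambda>n. tau n \<omega>)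
                  (\<lambda>k. y k \<omega>) (\<lambda>k. u k \<omega>) (\<lambda>k. ud k \<omega>)"
    and phi: "spectral_factor tmax \<alpha> p \<Phi>"
  shows "convergent (\<lambda>k. prob_space.expectation M (\<lambda>\<omega>. (u k \<omega>)\<^sup>2)) \<and>
         (\<lambda>k. prob_space.expectation M (\<lambda>\<omega>. (u k \<omega>)\<^sup>2)) \<longlonglongrightarrow>
           h2sq (G_tf Pn Pd Kn Kd tmax \<alpha> p) /
             (1 - h2sq (\<lambda>z. evz \<Phi> z * G_tf Pn Pd Kn Kd tmax \<alpha> p z)) * \<sigma>v2"
proof -
  interpret prob_space M by fact
  define N D where "N = G_num Pn Pd Kn Kd" and "D = G_den Pn Pd Kn Kd tmax \<alpha> p"
  define g C where "g = (\<lambda>k. tf_fps N D $ k)"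
    and "C = (\<lambda>t m. tf_fps (dev_poly tmax \<alpha> p t * N) D $ m)"
  define b where "b m = (\<Sum>t\<le>tmax. p t * (C t m)\<^sup>2)" for m
  note p_sum = \<open>(\<Sum>i\<le>tmax. p i) = 1\<close>
  have D0: "coeff D 0 \<noteq> 0"
    unfolding D_def by (rule coeff_0_G_den[OF plant_strictly_proper controller_proper])
  have N0: "coeff N 0 = 0"
    using plant_strictly_proper by (simp add: N_def G_num_def coeff_mult)
  have st: "stable_tf N D"
    using ms by (simp add: ms_stable_def N_def D_def)
  have C_mean: "(\<Sum>t\<le>tmax. p t * C t m) = 0" for m
    unfolding C_def by (rule dev_response_mean_zero[OF D0 p_sum])
  have b0: "b 0 = 0"
    using N0 D0 by (simp add: b_def C_def tf_fps_def fps_divide_unit coeff_mult)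
  have b_nonneg: "0 \<le> b m" for m
    unfolding b_def using \<open>\<forall>i. 0 \<le> p i\<close> by (intro sum_nonneg mult_nonneg_nonneg) auto
  have b_sum: "summable b" "suminf b = h2sq (\<lambda>z. evz \<Phi> z * G_tf Pn Pd Kn Kd tmax \<alpha> p z)"
    using h2sq_spectral_factor[OF D0 st phi p_sum]
    by (simp_all add: b_def[abs_def] C_def G_tf_def N_def D_def)
  have g_sum: "summable (\<lambda>k. (g k)\<^sup>2)" "(\<Sum>k. (g k)\<^sup>2) = h2sq (G_tf Pn Pd Kn Kd tmax \<alpha> p)"
    using stable_tf_parseval(2)[OF D0 st] h2sq_tf[OF D0 st]
    by (simp_all add: g_def G_tf_def[abs_def] N_def D_def)
  \<comment> \<open>The kernel depends on the loop and the delay distribution but not on the input,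
    so its summability may be established with the test input and then used for
    \<open>v\<close>.\<close>
  have kernel: "summable (\<lambda>k. renewal_kernel b $ k)"
  proof (cases "\<exists>m. g m \<noteq> 0")
    case True
    then obtain m where m: "g m \<noteq> 0"
      by blast
    let ?N = "test_law M tau"
    interpret test: delay_feedback ?N tmax p "\<lambda>n x. snd x n" "\<lambda>k x. fst x k" g C
      unfolding delay_feedback_def delay_feedback_axioms_def
      using prob_space_test_law[OF delays] test_law_delays[OF delays] test_law_noise(1)[OF delays]
        test_law_indep[OF delays] C_mean by blast
    define s where "s k = test.expectation (\<lambda>x. (test.control k x)\<^sup>2)" for k
    have control: "(\<lambda>k. test.control k x) = loop_resp g C (fst x) (snd x)" for x
      by (intro ext) (simp add: test.control_def)
    \<comment> \<open>A plant output is needed for every path before the stability hypothesis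
      applies to the recursively defined control.\<close>
    have "\<exists>y. loop_eqs Pn Pd Kn Kd tmax \<alpha> (fst x) (snd x) y (\<lambda>k. test.control k x)
        (chan_out tmax \<alpha> (snd x) (\<lambda>k. test.control k x))" for x
      unfolding control unfolding g_def C_def N_def D_def
      by (rule loop_eqs_exist[OF plant_strictly_proper controller_proper])
    then obtain y' where "loop_eqs Pn Pd Kn Kd tmax \<alpha> (fst x) (snd x) (y' x) (\<lambda>k. test.control k x)
        (chan_out tmax \<alpha> (snd x) (\<lambda>k. test.control k x))" for x
      by metis
    then obtain B where B: "s k \<le> B" for k
      using ms[unfolded ms_stable_def, THEN conjunct2, rule_format, of ?N y'
          "\<lambda>x k. test.control k x" "\<lambda>x. chan_out tmax \<alpha> (snd x) (\<lambda>k. test.control k x)"]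
        prob_space_test_law[OF delays] sets_test_law[OF delays] test_law_delays[OF delays]
        test_law_noise(1)[OF delays] test_law_indep[OF delays]
      unfolding s_def by blast
    have s: "s k = (\<Sum>j\<le>k. (g j)\<^sup>2) + (\<Sum>n<k. s n * b (k - n))" for k
      using test.control_second_moment[of k] unfolding s_def b_def test_law_noise(2)[OF delays] by simp
    show ?thesis
    \<comment> \<open>With unit input variance the forcing term is a partial sum of squares of
      \<open>g\<close>; from index \<open>m\<close> on it is at least the positive number
      \<open>(g m)\<^sup>2\<close>.\<close>
    proof (rule renewal_kernel_summable[OF b0 b_nonneg s B])
      show "0 < (g m)\<^sup>2"
        using m by simp
      show "(g m)\<^sup>2 \<le> (\<Sum>j\<le>k. (g j)\<^sup>2)" if "m \<le> k" for k
        using that by (intro member_le_sum) auto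
    qed (auto intro: sum_nonneg)
  next
    case False
    \<comment> \<open>When \<open>G = 0\<close> the forcing term gives no lower bound, but then
      every deviation response vanishes as well and the kernel is the constant series 1.\<close>
    then have "tf_fps N D = 0"
      unfolding g_def by (intro fps_ext) simp
    then have "Abs_fps b = 0"
      by (intro fps_ext) (simp add: b_def C_def tf_fps_mult[OF D0])
    then have "renewal_kernel b = 1"
      by (simp add: renewal_kernel_def)
    then show ?thesis
      using summable_single[of 0 "\<lambda>_. 1 :: real"] by (simp add: fps_one_nth)
  qed
  have noise: "white_noise M v"
    using v_indep v_sq v_mean v_bdd by (intro white_noise_of_indep) auto
  interpret delay_feedback M tmax p tau v g C
    using delays noise v_tau C_mean by unfold_locales
  \<comment> \<open>The loop equations have a unique solution on each path, so the given
    \<open>u\<close> is the recursive control process.\<close>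
  have u: "u k \<omega> = control k \<omega>" if "\<omega> \<in> space M" for k \<omega>
    using loop_eqs_unique[OF plant_strictly_proper controller_proper loop[rule_format, OF that], of p]
    unfolding control_def unfolding g_def C_def N_def D_def by (rule fun_cong)
  define s where "s k = expectation (\<lambda>\<omega>. (u k \<omega>)\<^sup>2)" for k
  have s_control: "s k = expectation (\<lambda>\<omega>. (control k \<omega>)\<^sup>2)" for k
    unfolding s_def using u by (intro Bochner_Integration.integral_cong) auto
  have s: "s k = (\<Sum>j\<le>k. (g j)\<^sup>2 * expectation (\<lambda>\<omega>. (v (k - j) \<omega>)\<^sup>2)) +
      (\<Sum>n<k. s n * b (k - n))" for k
    unfolding s_control b_def by (rule control_second_moment)
  have "s \<longlonglongrightarrow> (\<Sum>k. (g k)\<^sup>2) * \<sigma>v2 / (1 - suminf b)"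
  proof (rule renewal_limit[OF b0 b_nonneg b_sum(1) kernel s])
    show "(\<lambda>k. \<Sum>j\<le>k. (g j)\<^sup>2 * expectation (\<lambda>\<omega>. (v (k - j) \<omega>)\<^sup>2)) \<longlonglongrightarrow>
        (\<Sum>k. (g k)\<^sup>2) * \<sigma>v2"
      using g_sum(1) v_lim by (intro tendsto_convolution) auto
  qed
  then show ?thesis
    unfolding s_def[abs_def] g_sum(2) b_sum(2) by (auto simp: convergent_def)
qed

end
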